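(* Let $a,b$ be nonnegative integers and $c$ a positive integer such that the quaternary form $f(x,y,z,w)=x^2+2y^2+4z^2+cw^2+2bzw+2ayw$ is positive definite, and such that one of the following holds: (1) $b\equiv 1\pmod 2$; (2) $a\equiv c\equiv 0\pmod 2$ and $b\equiv 2\pmod 4$. Put $t=4c-2a^2-b^2$, and let $s=2$ in case (1) and $s=1$ in case (2). Then $f$ primitively represents every integer greater than $4s^2t$, i.e. for every integer $n>4s^2t$ there are $x,y,z,w\in\mathbb{Z}$ with $\gcd(x,y,z,w)=1$ and $f(x,y,z,w)=n$. *)

theory Defs
  imports Complex_Main
begin

(* The form has integer coefficients but is evaluated over any commutative ring: real arguments
   are used for positive definiteness, integer arguments for representations. *)
definition qform :: "int \<Rightarrow> int \<Rightarrow> int \<Rightarrow> 'r::comm_ring_1 \<Rightarrow> 'r \<Rightarrow> 'r \<Rightarrow> 'r \<Rightarrow> 'r" where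
  "qform a b c x y z w =
     x^2 + 2 * y^2 + 4 * z^2 + of_int c * w^2 + 2 * of_int b * z * w + 2 * of_int a * y * w"

definition positive_definite4 :: "(real \<Rightarrow> real \<Rightarrow> real \<Rightarrow> real \<Rightarrow> real) \<Rightarrow> bool" where
  "positive_definite4 f \<longleftrightarrow> (\<forall>x y z w. (x, y, z, w) \<noteq> (0, 0, 0, 0) \<longrightarrow> f x y z w > 0)"

definition primitively_represents4 :: "(int \<Rightarrow> int \<Rightarrow> int \<Rightarrow> int \<Rightarrow> int) \<Rightarrow> int \<Rightarrow> bool" where
  "primitively_represents4 f n \<longleftrightarrow> (\<exists>x y z w. Gcd {x, y, z, w} = 1 \<and> f x y z w = n)"

end

theory Submission
  imports Defs "HOL-Number_Theory.Number_Theory" "HOL-Computational_Algebra.Squarefree"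
    "HOL-Analysis.Summation_Tests" "HOL-Library.Discrete_Functions"
begin

text \<open>
  Completing squares gives \<open>4 f = (2x)\<^sup>2 + 2 (2y + aw)\<^sup>2 + (4z + bw)\<^sup>2 + t w\<^sup>2\<close>, so after fixing
  \<open>w \<in> {1, 2}\<close> it suffices that \<open>X\<^sup>2 + Z\<^sup>2 + 2 Y\<^sup>2\<close> represents every odd positive number: the congruences
  on \<open>X, Y, Z\<close> are then automatic. This is Legendre's three squares theorem for the numbers \<open>2 N\<close>
  with \<open>N\<close> odd, and \<open>N\<close> may be taken squarefree. Choose a prime \<open>p \<equiv> 1\<close> modulo 4 such that \<open>-p\<close> is a
  square modulo \<open>2 N\<close> and \<open>2 N\<close> a square modulo \<open>p\<close>. Then \<open>2 N w\<^sup>2 = A\<^sup>2 + p B\<^sup>2\<close> is solvable by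
  pigeonhole, and as \<open>p\<close> is a sum of two squares, \<open>2 N\<close> is a sum of three rational squares, hence of
  three integral ones by the Davenport--Cassels descent.

  The prime \<open>p\<close> is only constrained by the values of finitely many quadratic characters, so the
  elementary proof of Dirichlet's theorem with real characters suffices to produce it.
\<close>

section \<open>Real characters and the values of their L-functions at 1\<close>

text \<open>The conditions on \<open>p\<close> must be compatible, and the factor 2 makes them so.
  Each prime \<open>q\<close> of \<open>N\<close> forces (p/q) = (-1/q). Since \<open>p\<close> is 1
  modulo 4, reciprocity carries no sign, so (N/p) is the product \<delta> of these symbols. Choosing
  (2/p) = \<delta>, i.e. \<open>p\<close> in class 1 or 5 modulo 8, gives (2N/p) = \<delta> *
  \<delta> = 1. Without this free symbol \<delta> = -1 would be an obstruction.

  The analytic part never isolates a single residue class. It weights \<open>n\<close> by the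
  product of the factors \<open>\<epsilon> i * \<eta> i n + 1\<close>, whose expansion contains only
  products of real characters; hence only real L-values at 1 have to be shown nonzero. Divergence is
  read off from finite sums of \<open>\<Lambda> n / n\<close>, so no complex analysis
  enters.\<close>

text \<open>Both sides run over the pairs with \<open>d * j \<le> X\<close>. The exchange serves the
  Lambert series, the logarithm of the factorial and the convolution of
  \<open>\<eta> * \<Lambda>\<close> with \<open>\<eta>\<close>.\<close>

lemma sum_sum_divisors:
  fixes g :: "nat \<Rightarrow> nat \<Rightarrow> 'a :: comm_monoid_add"
  shows "(\<Sum>n=1..X. \<Sum>d | d dvd n. g d (n div d)) = (\<Sum>d=1..X. \<Sum>j=1..X div d. g d j)"
proof -
  have "(\<Sum>n=1..X. \<Sum>d | d dvd n. g d (n div d)) =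
        (\<Sum>(n,d)\<in>(SIGMA n:{1..X}. {d. d dvd n}). g d (n div d))"
    by (rule sum.Sigma) (auto intro: finite_divisors_nat)
  also have "\<dots> = (\<Sum>(d,j)\<in>(SIGMA d:{1..X}. {1..X div d}). g d j)"
  proof (rule sum.reindex_bij_witness[of _ "\<lambda>(d,j). (d*j,d)" "\<lambda>(n,d). (d, n div d)"], goal_cases)
    case (1 a) then show ?case by auto
  next
    case (2 a)
    then obtain n d where a: "a = (n,d)" "1 \<le> n" "n \<le> X" "d dvd n" by auto
    then have "0 < d" "d \<le> n" by (auto dest: dvd_imp_le intro: Nat.gr0I)
    with a show ?case by (auto simp: div_le_mono Suc_le_eq div_greater_zero_iff)
  next
    case (3 b) then show ?case by auto
  next
    case (4 b)
    then obtain d j where b: "b = (d,j)" "1 \<le> d" "1 \<le> j" "j \<le> X div d" by auto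
    then have "j * d \<le> X" by (simp add: less_eq_div_iff_mult_less_eq)
    with b show ?case by (auto simp: mult.commute)
  next
    case (5 a) then show ?case by auto
  qed
  also have "\<dots> = (\<Sum>d=1..X. \<Sum>j=1..X div d. g d j)"
    by (rule sum.Sigma[symmetric]) auto
  finally show ?thesis .
qed

text \<open>Vanishing at non-units is not imposed: a character of any modulus dividing
  \<open>k\<close> qualifies, so characters of different moduli can be multiplied over one common
  \<open>k\<close>.\<close>

definition real_char :: "nat \<Rightarrow> (nat \<Rightarrow> real) \<Rightarrow> bool" where
  "real_char k \<eta> \<longleftrightarrow> (\<forall>m n. \<eta> (m * n) = \<eta> m * \<eta> n) \<and> (\<forall>n. \<eta> (n + k) = \<eta> n) \<and>
     (\<forall>n. \<eta> n \<in> {-1, 0, 1}) \<and> \<eta> 1 = 1"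

lemma real_charD:
  assumes "real_char k \<eta>"
  shows "\<eta> (m * n) = \<eta> m * \<eta> n" "\<eta> (n + k) = \<eta> n" "\<eta> n \<in> {-1, 0, 1}" "\<eta> 1 = 1"
  using assms by (auto simp: real_char_def)

lemma real_char_abs_le: "real_char k \<eta> \<Longrightarrow> \<bar>\<eta> n\<bar> \<le> 1"
  using real_charD(3)[of k \<eta> n] by auto

lemma real_char_mod:
  assumes "real_char k \<eta>"
  shows "\<eta> (n mod k) = \<eta> n"
proof -
  have "\<eta> (r + q * k) = \<eta> r" for q r
  proof (induction q)
    case (Suc q)
    have "\<eta> (r + Suc q * k) = \<eta> ((r + q * k) + k)" by (simp add: algebra_simps)
    then show ?case using Suc real_charD(2)[OF assms] by simp
  qed simp
  from this[of "n mod k" "n div k"] show ?thesis by simp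
qed

text \<open>Multiplication by the unit \<open>a\<close> permutes the residues and changes the sign
  of the sum.\<close>

lemma real_char_sum_period:
  assumes \<eta>: "real_char k \<eta>" and "k > 0" and "\<eta> a = -1" and "coprime a k"
  shows "(\<Sum>n<k. \<eta> n) = 0"
proof -
  have inj: "inj_on (\<lambda>n. a * n mod k) {..<k}"
  proof (rule inj_onI)
    fix x y assume xy: "x \<in> {..<k}" "y \<in> {..<k}" "a * x mod k = a * y mod k"
    then have "[x = y] (mod k)"
      using \<open>coprime a k\<close> cong_mult_lcancel_nat by (auto simp: cong_def)
    with xy show "x = y" by (simp add: cong_def)
  qed
  have "(\<lambda>n. a * n mod k) ` {..<k} \<subseteq> {..<k}" using \<open>k > 0\<close> by auto
  then have "bij_betw (\<lambda>n. a * n mod k) {..<k} {..<k}"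
    using inj by (simp add: bij_betw_def endo_inj_surj)
  then have "(\<Sum>n<k. \<eta> n) = (\<Sum>n<k. \<eta> (a * n mod k))"
    by (rule sum.reindex_bij_betw[symmetric])
  also have "\<dots> = - (\<Sum>n<k. \<eta> n)"
    by (simp add: real_char_mod[OF \<eta>] real_charD(1)[OF \<eta>] assms sum_negf)
  finally show ?thesis by simp
qed

text \<open>Nontriviality is encoded as a vanishing sum over one period, the form in which it bounds
  all partial sums of \<eta>.\<close>

locale nontrivial_real_char =
  fixes k :: nat and \<eta> :: "nat \<Rightarrow> real"
  assumes k_pos: "k > 0" and char: "real_char k \<eta>" and sum_period: "(\<Sum>n<k. \<eta> n) = 0"
begin

lemmas abs_le = real_char_abs_le[OF char]
lemmas eta_mult = real_charD(1)[OF char]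
lemmas eta_values = real_charD(3)[OF char]
lemmas eta_one = real_charD(4)[OF char]

lemma abs_sum_lessThan_le: "\<bar>\<Sum>n<x. \<eta> n\<bar> \<le> k"
proof (induction x rule: less_induct)
  case (less x)
  show ?case
  proof (cases "x < k")
    case True
    have "\<bar>\<Sum>n<x. \<eta> n\<bar> \<le> (\<Sum>n<x. 1)"
      by (rule order.trans[OF sum_abs sum_mono]) (rule abs_le)
    then show ?thesis using True by simp
  next
    case False
    then obtain m where m: "x = k + m" by (metis le_add_diff_inverse not_less)
    have "(\<Sum>n<x. \<eta> n) = (\<Sum>n<k. \<eta> n) + (\<Sum>n<m. \<eta> (n + k))"
      unfolding m by (induction m) (auto simp: add_ac)
    also have "\<dots> = (\<Sum>n<m. \<eta> n)" by (simp add: sum_period real_charD(2)[OF char])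
    finally show ?thesis using less[of m] m k_pos by simp
  qed
qed

lemma abs_sum_atLeastLessThan_le: "\<bar>\<Sum>n=m..<x. \<eta> n\<bar> \<le> 2 * k"
proof (cases "m \<le> x")
  case True
  have "(\<Sum>n<x. \<eta> n) = (\<Sum>n<m. \<eta> n) + (\<Sum>n=m..<x. \<eta> n)"
    using True by (metis atLeast0LessThan le0 sum.atLeastLessThan_concat)
  then show ?thesis using abs_sum_lessThan_le[of x] abs_sum_lessThan_le[of m] by linarith
qed simp

text \<open>Summation by parts: the sums of \<eta> over intervals are bounded by
  \<open>2 * k\<close>, and the decrements of the monotone weight telescope to its first
  value.\<close>

lemma abs_sum_mult_le:
  fixes f :: "nat \<Rightarrow> real"
  assumes f_nonneg: "\<And>n. n \<ge> m \<Longrightarrow> f n \<ge> 0" and f_dec: "\<And>n. n \<ge> m \<Longrightarrow> f (Suc n) \<le> f n"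
  shows "\<bar>\<Sum>n=m..<x. \<eta> n * f n\<bar> \<le> 2 * k * f m"
proof (cases "m \<le> x")
  case True
  define S where "S = (\<lambda>y. \<Sum>n=m..<y. \<eta> n)"
  have "(\<Sum>n=m..<x. \<eta> n * f n) = S x * f x + (\<Sum>n=m..<x. S (Suc n) * (f n - f (Suc n)))"
    using True
  proof (induction x rule: dec_induct)
    case (step y)
    have "S (Suc y) = S y + \<eta> y" using step by (simp add: S_def)
    then show ?case using step by (simp add: algebra_simps)
  qed (simp add: S_def)
  also have "\<bar>\<dots>\<bar> \<le> \<bar>S x * f x\<bar> + (\<Sum>n=m..<x. \<bar>S (Suc n) * (f n - f (Suc n))\<bar>)"
    by (rule order.trans[OF abs_triangle_ineq add_left_mono[OF sum_abs]])
  also have "\<dots> \<le> 2 * k * f x + (\<Sum>n=m..<x. 2 * k * (f n - f (Suc n)))"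
  proof (intro add_mono sum_mono)
    show "\<bar>S x * f x\<bar> \<le> 2 * k * f x" using f_nonneg[OF True] abs_sum_atLeastLessThan_le[of m x]
      by (simp add: abs_mult S_def mult_right_mono)
    show "\<bar>S (Suc n) * (f n - f (Suc n))\<bar> \<le> 2 * k * (f n - f (Suc n))" if "n \<in> {m..<x}" for n
      using f_dec[of n] that abs_sum_atLeastLessThan_le[of m "Suc n"]
      by (simp add: abs_mult S_def mult_right_mono)
  qed
  also have "\<dots> = 2 * k * (f x + (\<Sum>n=m..<x. f n - f (Suc n)))"
    by (simp add: sum_distrib_left algebra_simps)
  also have "\<dots> = 2 * k * f m"
    using sum_Suc_diff'[of m x "\<lambda>n. - f n"] True by simp
  finally show ?thesis .
qed (use f_nonneg[of m] in simp)

lemma abs_sum_over_n_le: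
  assumes "m > 0"
  shows "\<bar>\<Sum>n=m..<x. \<eta> n / n\<bar> \<le> 2 * k / m"
  using abs_sum_mult_le[of m "\<lambda>n. 1 / n" x] assms by (simp add: field_simps)

lemma summable_L: "summable (\<lambda>n. \<eta> n / n)"
proof (rule summable_Cauchy[THEN iffD2], intro allI impI)
  fix e :: real assume "e > 0"
  obtain N :: nat where N: "2 * k / e < N" using reals_Archimedean2 by blast
  have "norm (\<Sum>n=m..<x. \<eta> n / n) < e" if "m \<ge> Suc N" for m x
  proof -
    have "2 * k / m < e" using N that \<open>e > 0\<close> by (simp add: field_simps) (smt (verit) mult_left_mono of_nat_Suc of_nat_mono)
    then show ?thesis using abs_sum_over_n_le[of m x] that by simp
  qed
  then show "\<exists>N. \<forall>m\<ge>N. \<forall>n. norm (\<Sum>n=m..<n. \<eta> n / n) < e" by blast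
qed

text \<open>The term at 0 is a division by zero, hence 0, so this is the usual value L(1,
  \<eta>).\<close>

definition L :: real where "L = (\<Sum>n. \<eta> n / n)"

lemma abs_L_diff_le: "\<bar>L - (\<Sum>n=1..x. \<eta> n / n)\<bar> \<le> 2 * k / (real x + 1)"
proof -
  have "(\<lambda>n. \<Sum>n<n. \<eta> n / n) \<longlonglongrightarrow> L"
    unfolding L_def by (rule summable_LIMSEQ[OF summable_L])
  then have "(\<lambda>y. \<bar>(\<Sum>n<y. \<eta> n / n) - (\<Sum>n=1..x. \<eta> n / n)\<bar>) \<longlonglongrightarrow> \<bar>L - (\<Sum>n=1..x. \<eta> n / n)\<bar>"
    by (intro tendsto_intros)
  moreover have "\<bar>(\<Sum>n<y. \<eta> n / n) - (\<Sum>n=1..x. \<eta> n / n)\<bar> \<le> 2 * k / (real x + 1)" if "y \<ge> Suc x" for y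
  proof -
    have "(\<Sum>n<y. \<eta> n / n) = (\<Sum>n<Suc x. \<eta> n / n) + (\<Sum>n=Suc x..<y. \<eta> n / n)"
      using that by (metis atLeast0LessThan le0 sum.atLeastLessThan_concat)
    moreover have "(\<Sum>n<Suc x. \<eta> n / n) = (\<Sum>n=1..x. \<eta> n / n)"
      by (intro sum.mono_neutral_right) (auto simp: Suc_le_eq)
    ultimately show ?thesis using abs_sum_over_n_le[of "Suc x" y] by (simp add: add_ac)
  qed
  ultimately show ?thesis by (intro Lim_bounded[where M = "Suc x"]) auto
qed

end

section \<open>Divisor sums of a real character and the nonvanishing of L(1)\<close>

lemma sum_powers_of_unit_nonneg:
  fixes v :: real
  assumes "v \<in> {-1, 0, 1}"
  shows "(\<Sum>i\<le>a. v ^ i) \<ge> (if even a then 1 else 0)"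
proof -
  have "(\<Sum>i\<le>a. (-1::real) ^ i) = (if even a then 1 else 0)" by (induction a) auto
  moreover have "(\<Sum>i\<le>a. (0::real) ^ i) = 1" by (induction a) auto
  ultimately show ?thesis using assms by auto
qed

text \<open>The exponents \<open>2 * i\<close> and \<open>2 * (n - 1 - i)\<close> have mean
  \<open>n - 1\<close>, so the arithmetic-geometric inequality applies to each pair. It yields the
  monotonicity of the weights \<open>b\<close> in the Lambert series.\<close>

lemma sum_powers_amgm:
  fixes r :: real
  assumes "r > 0"
  shows "real n * r ^ (n - 1) \<le> (\<Sum>i<n. (r\<^sup>2) ^ i)"
proof -
  have "2 * (real n * r ^ (n - 1)) = (\<Sum>i<n. 2 * r ^ (n - 1))" by simp
  also have "\<dots> \<le> (\<Sum>i<n. (r\<^sup>2) ^ i + (r\<^sup>2) ^ (n - Suc i))"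
  proof (rule sum_mono)
    fix i assume "i \<in> {..<n}"
    then have *: "r ^ (n - 1) = r ^ i * r ^ (n - Suc i)" by (simp flip: power_add)
    show "2 * r ^ (n - 1) \<le> (r\<^sup>2) ^ i + (r\<^sup>2) ^ (n - Suc i)"
      using sum_squares_bound[of "r ^ i" "r ^ (n - Suc i)"] unfolding *
      by (simp add: power2_eq_square power_mult_distrib)
  qed
  also have "\<dots> = 2 * (\<Sum>i<n. (r\<^sup>2) ^ i)"
    by (simp add: sum.distrib sum.nat_diff_reindex[of "\<lambda>i. (r\<^sup>2) ^ i"])
  finally show ?thesis by simp
qed

context nontrivial_real_char
begin

lemma eta_power: "\<eta> (p ^ i) = \<eta> p ^ i"
  using eta_one by (induction i) (simp_all add: eta_mult)

lemma sum_divisors_prime_power_mult: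
  fixes p :: nat
  assumes "prime p" "\<not> p dvd m" "m > 0"
  shows "(\<Sum>d | d dvd p ^ a * m. \<eta> d) = (\<Sum>i\<le>a. \<eta> p ^ i) * (\<Sum>d | d dvd m. \<eta> d)"
proof -
  have mult_eq: "multiplicity p (p ^ i * d) = i" if "d dvd m" for i d
  proof (rule multiplicity_eqI)
    show "\<not> p ^ Suc i dvd p ^ i * d"
      using assms that by (metis dvd_times_left_cancel_iff dvd_trans not_prime_0 power_Suc2 power_not_zero)
  qed simp
  have inj: "inj_on (\<lambda>(i, d). p ^ i * d) ({..a} \<times> {d. d dvd m})"
  proof (rule inj_onI, clarify)
    fix i d j e assume *: "d dvd m" "e dvd m" "p ^ i * d = p ^ j * e"
    then have "i = j" using mult_eq by metis
    with * show "i = j \<and> d = e" using assms by (auto simp: prime_gt_0_nat)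
  qed
  have img: "(\<lambda>(i, d). p ^ i * d) ` ({..a} \<times> {d. d dvd m}) = {d. d dvd p ^ a * m}"
  proof (intro equalityI subsetI)
    fix x assume "x \<in> {d. d dvd p ^ a * m}"
    then obtain u v where uv: "x = u * v" "u dvd p ^ a" "v dvd m"
      using division_decomp by blast
    then obtain i where "i \<le> a" "u = p ^ i" using divides_primepow_nat[OF assms(1)] by blast
    with uv show "x \<in> (\<lambda>(i, d). p ^ i * d) ` ({..a} \<times> {d. d dvd m})" by force
  qed (auto simp: mult_dvd_mono le_imp_power_dvd)
  have "(\<Sum>d | d dvd p ^ a * m. \<eta> d) = (\<Sum>(i, d)\<in>{..a} \<times> {d. d dvd m}. \<eta> p ^ i * \<eta> d)"
    unfolding img[symmetric] by (subst sum.reindex[OF inj]) (auto intro!: sum.cong simp: eta_mult eta_power)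
  then show ?thesis by (simp add: sum_product sum.cartesian_product)
qed

lemma prime_power_part:
  fixes m :: nat
  assumes "m > 1"
  obtains p a m' where "prime p" "\<not> p dvd m'" "m = p ^ a * m'" "0 < m'" "m' < m"
proof -
  obtain p where p: "prime p" "p dvd m" using assms prime_factor_nat[of m] by auto
  have "m \<noteq> 0" "\<not> is_unit p" using assms p by auto
  then obtain m' where m': "m = p ^ multiplicity p m * m'" "\<not> p dvd m'"
    by (rule multiplicity_decompose')
  have "multiplicity p m > 0" using p assms prime_multiplicity_gt_zero_iff[of p m] by auto
  then have "p ^ multiplicity p m > 1" using p by (metis one_less_power prime_gt_1_nat)
  moreover have "m' > 0" using m' assms by (intro Nat.gr0I) auto
  ultimately have "m' < m" using m'(1) by (metis mult_less_cancel2 nat_mult_1)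
  with p m' \<open>m' > 0\<close> show ?thesis using that by blast
qed

lemma sum_divisors_nonneg: "m > 0 \<Longrightarrow> (\<Sum>d | d dvd m. \<eta> d) \<ge> 0"
proof (induction m rule: less_induct)
  case (less m)
  show ?case
  proof (cases "m > 1")
    case True
    then obtain p a m' where m': "prime p" "\<not> p dvd m'" "m = p ^ a * m'" "0 < m'" "m' < m"
      by (rule prime_power_part)
    have "(\<Sum>i\<le>a. \<eta> p ^ i) \<ge> 0"
      using sum_powers_of_unit_nonneg[OF eta_values[of p], of a] by (auto split: if_splits)
    then show ?thesis unfolding \<open>m = p ^ a * m'\<close>
      using sum_divisors_prime_power_mult[OF m'(1,2,4)] less.IH[OF m'(5,4)] by simp
  next
    case False
    then have "m = 1" using less by simp
    then show ?thesis using eta_one by simp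
  qed
qed

text \<open>All exponents of a square are even, and a geometric sum
  \<open>1 + v + ... + v ^ (2 * a)\<close> with \<open>v\<close> in {-1, 0, 1} is at least
  1.\<close>

lemma sum_divisors_square_ge_1: "m > 0 \<Longrightarrow> (\<Sum>d | d dvd m\<^sup>2. \<eta> d) \<ge> 1"
proof (induction m rule: less_induct)
  case (less m)
  show ?case
  proof (cases "m > 1")
    case True
    then obtain p a m' where m': "prime p" "\<not> p dvd m'" "m = p ^ a * m'" "0 < m'" "m' < m"
      by (rule prime_power_part)
    have m2: "m\<^sup>2 = p ^ (2 * a) * m'\<^sup>2"
      by (simp add: m' power_mult_distrib power_mult[symmetric] mult.commute)
    have "\<not> p dvd m'\<^sup>2" using m' prime_dvd_power by blast
    moreover have "(\<Sum>i\<le>2*a. \<eta> p ^ i) \<ge> 1"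
      using sum_powers_of_unit_nonneg[OF eta_values[of p], of "2 * a"] by auto
    ultimately show ?thesis unfolding m2
      using sum_divisors_prime_power_mult[OF m'(1), of "m'\<^sup>2" "2 * a"] less.IH[OF m'(5,4)] m'(4)
      by (simp add: mult_ge1_I)
  next
    case False
    then have "m = 1" using less by simp
    then show ?thesis using eta_one by simp
  qed
qed

text \<open>
  Monsky's argument: the Lambert series \<open>\<Sum> \<eta> d * x\<^sup>d / (1 - x\<^sup>d)\<close> dominates \<open>\<Sum> x ^ m\<^sup>2\<close>, which is
  unbounded as \<open>x\<close> tends to 1; but if \<open>L = 0\<close>, then subtracting \<open>\<Sum> \<eta> d / (d * (1 - x))\<close> leaves a
  sum with monotone weights \<open>b\<close>, which is bounded.
\<close>

lemma lambert_bound: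
  assumes x: "0 < x" "x < 1" and L: "L = 0"
  shows "\<bar>\<Sum>d=1..D. \<eta> d * (x ^ d / (1 - x ^ d))\<bar> \<le> 2 * k + 2 * k / ((1 - x) * (real D + 1))"
proof -
  define G where "G n = (\<Sum>i<n. x ^ i)" for n
  define b where "b n = 1 / (real n * (1 - x)) - x ^ n / (1 - x ^ n)" for n
  have G_pos: "G n > 0" if "n > 0" for n
    unfolding G_def using that x by (intro sum_pos) auto
  have G_eq: "1 - x ^ n = (1 - x) * G n" for n unfolding G_def by (rule one_diff_power_eq)
  have b_eq: "b n = (1 / real n - x ^ n / G n) / (1 - x)" for n
    by (simp add: b_def G_eq diff_divide_distrib)
  have b_nonneg: "b n \<ge> 0" if "n \<ge> 1" for n
  proof -
    have "real n * x ^ n = (\<Sum>i<n. x ^ n)" by simp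
    also have "\<dots> \<le> G n" unfolding G_def using x by (intro sum_mono power_decreasing) auto
    finally have "x ^ n / G n \<le> 1 / n" using G_pos[of n] that by (simp add: field_simps)
    then show ?thesis using x by (simp add: b_eq)
  qed
  have b_dec: "b (Suc n) \<le> b n" if "n \<ge> 1" for n
  proof -
    \<comment> \<open>After clearing denominators, monotonicity of \<open>b\<close> is
      \<open>n * (n + 1) * x ^ n \<le> G n * G (n + 1)\<close>. The square root lets
      \<open>x ^ n\<close>, at most \<open>r ^ (2 * n - 1)\<close>, split into the factors
      \<open>r ^ (n - 1)\<close> and \<open>r ^ n\<close> that the two mean inequalities
      provide.\<close>
    define r where "r = sqrt x"
    have r: "x = r\<^sup>2" "r > 0" "r < 1" using x by (auto simp: r_def)
    have "(real n * real (Suc n)) * x ^ n \<le> (real n * real (Suc n)) * (r ^ (n - 1) * r ^ n)"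
    proof (rule mult_left_mono)
      have "x ^ n = r ^ (n + n)" by (simp add: r flip: power_mult mult_2)
      also have "\<dots> \<le> r ^ (n - 1 + n)" using r by (intro power_decreasing) auto
      finally show "x ^ n \<le> r ^ (n - 1) * r ^ n" by (simp add: power_add)
    qed auto
    also have "\<dots> = (real n * r ^ (n - 1)) * (real (Suc n) * r ^ (Suc n - 1))" by simp
    also have "\<dots> \<le> G n * G (Suc n)"
      unfolding G_def r(1)
      using sum_powers_amgm[OF r(2), of n] sum_powers_amgm[OF r(2), of "Suc n"] r(2)
      by (intro mult_mono) (auto intro!: sum_nonneg simp del: sum.lessThan_Suc)
    finally have *: "real n * real (Suc n) * x ^ n \<le> G n * G (Suc n)" .
    have "G (Suc n) = 1 + x * G n"
      using G_eq[of n] by (simp add: G_def algebra_simps)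
    then have "x ^ n / G n - x ^ Suc n / G (Suc n) = x ^ n / (G n * G (Suc n))"
      using G_pos[of n] G_pos[of "Suc n"] that by (simp add: field_simps)
    also have "\<dots> \<le> 1 / (real n * real (Suc n))"
    proof -
      have "0 < G n * G (Suc n)" "0 < real n * real (Suc n)"
        using G_pos[of n] G_pos[of "Suc n"] that by simp_all
      with * show ?thesis by (simp only: pos_divide_le_eq times_divide_eq_left pos_le_divide_eq) (simp add: mult_ac)
    qed
    also have "\<dots> = 1 / real n - 1 / real (Suc n)" using that by (simp add: field_simps)
    finally show ?thesis unfolding b_eq using x by (intro divide_right_mono) auto
  qed
  have "b 1 = 1" using x by (simp add: b_def field_simps)
  then have b_sum: "\<bar>\<Sum>d=1..D. \<eta> d * b d\<bar> \<le> 2 * k"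
    using abs_sum_mult_le[of 1 b "Suc D"] b_nonneg b_dec by (simp add: atLeastLessThanSuc_atLeastAtMost)
  have "(\<Sum>d=1..D. \<eta> d * (x ^ d / (1 - x ^ d))) = (\<Sum>d=1..D. \<eta> d / d) / (1 - x) - (\<Sum>d=1..D. \<eta> d * b d)"
    by (simp add: b_def sum_divide_distrib algebra_simps flip: sum_subtractf)
  moreover have "\<bar>(\<Sum>d=1..D. \<eta> d / d) / (1 - x)\<bar> \<le> 2 * k / (real D + 1) / (1 - x)"
    using abs_L_diff_le[of D] x unfolding L abs_divide by (intro frac_le) auto
  moreover have "2 * k / (real D + 1) / (1 - x) = 2 * k / ((1 - x) * (real D + 1))" by simp
  ultimately show ?thesis using b_sum by linarith
qed

text \<open>A truncation at \<open>D\<close> of the comparison between the theta and Lambert series,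
  which avoids infinite double sums. The second term of the bound comes from the partial sum of
  \<open>L\<close>, the third from the cut-off geometric series; for fixed \<open>x\<close> both
  vanish as \<open>D\<close> grows.\<close>

lemma theta_bound:
  assumes x: "0 < x" "x < 1" and L: "L = 0" and D: "T\<^sup>2 \<le> D"
  shows "(\<Sum>m=1..T. x ^ m\<^sup>2) \<le> 2 * k + 2 * k / ((1 - x) * (real D + 1)) + real D * x ^ D / (1 - x)"
proof -
  have pow_less: "x ^ d < 1" if "d > 0" for d using x that by (intro power_Suc_less_one[of x "d - 1", simplified Suc_pred'[OF that, symmetric]]) auto
  have "(\<Sum>m=1..T. x ^ m\<^sup>2) = (\<Sum>n\<in>(\<lambda>m. m\<^sup>2) ` {1..T}. x ^ n)"
    by (subst sum.reindex) (auto intro!: inj_onI)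
  also have "\<dots> \<le> (\<Sum>n\<in>(\<lambda>m. m\<^sup>2) ` {1..T}. (\<Sum>d | d dvd n. \<eta> d) * x ^ n)"
    using x sum_divisors_square_ge_1 by (intro sum_mono) (auto simp: mult_le_cancel_right1)
  \<comment> \<open>Non-square indices may be added since their divisor sums are
    nonnegative.\<close>
  also have "\<dots> \<le> (\<Sum>n=1..D. (\<Sum>d | d dvd n. \<eta> d) * x ^ n)"
  proof (rule sum_mono2)
    show "(\<lambda>m. m\<^sup>2) ` {1..T} \<subseteq> {1..D}"
      using D by (auto intro: order.trans[OF power_mono])
    show "0 \<le> (\<Sum>d | d dvd n. \<eta> d) * x ^ n" if "n \<in> {1..D} - (\<lambda>m. m\<^sup>2) ` {1..T}" for n
      using that x sum_divisors_nonneg[of n] by simp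
  qed simp
  also have "\<dots> = (\<Sum>n=1..D. \<Sum>d | d dvd n. \<eta> d * x ^ (d * (n div d)))"
    by (intro sum.cong refl) (simp add: sum_distrib_right)
  also have "\<dots> = (\<Sum>d=1..D. \<Sum>j=1..D div d. \<eta> d * x ^ (d * j))" by (rule sum_sum_divisors)
  also have "\<dots> = (\<Sum>d=1..D. \<eta> d * (x ^ d / (1 - x ^ d)) - \<eta> d * (x ^ (d * (D div d) + d) / (1 - x ^ d)))"
  proof (intro sum.cong refl)
    fix d assume d: "d \<in> {1..D}"
    have "(1 - y) * (\<Sum>j=1..J. y ^ j) = y - y ^ Suc J" for J and y :: real
    proof (induction J)
      case (Suc J)
      have "(1 - y) * (\<Sum>j=1..Suc J. y ^ j) = (1 - y) * (\<Sum>j=1..J. y ^ j) + (1 - y) * y ^ Suc J"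
        by (simp add: distrib_left)
      also have "\<dots> = y - y ^ Suc (Suc J)" unfolding Suc.IH by (simp add: algebra_simps)
      finally show ?case .
    qed simp
    then have "(\<Sum>j=1..J. (x ^ d) ^ j) = (x ^ d - (x ^ d) ^ Suc J) / (1 - x ^ d)" for J
      using pow_less[of d] d by (simp add: nonzero_eq_divide_eq mult.commute)
    from this[of "D div d"] have "(\<Sum>j=1..D div d. x ^ (d * j)) = (x ^ d - x ^ (d * (D div d) + d)) / (1 - x ^ d)"
      by (simp add: power_mult[symmetric] power_add mult.commute)
    then show "(\<Sum>j=1..D div d. \<eta> d * x ^ (d * j)) =
        \<eta> d * (x ^ d / (1 - x ^ d)) - \<eta> d * (x ^ (d * (D div d) + d) / (1 - x ^ d))"
      by (simp add: sum_distrib_left[symmetric] diff_divide_distrib right_diff_distrib)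
  qed
  also have "\<dots> = (\<Sum>d=1..D. \<eta> d * (x ^ d / (1 - x ^ d))) - (\<Sum>d=1..D. \<eta> d * (x ^ (d * (D div d) + d) / (1 - x ^ d)))"
    by (rule sum_subtractf)
  also have "\<dots> \<le> \<bar>\<Sum>d=1..D. \<eta> d * (x ^ d / (1 - x ^ d))\<bar> + \<bar>\<Sum>d=1..D. \<eta> d * (x ^ (d * (D div d) + d) / (1 - x ^ d))\<bar>"
    by linarith
  also have "\<bar>\<Sum>d=1..D. \<eta> d * (x ^ (d * (D div d) + d) / (1 - x ^ d))\<bar> \<le> (\<Sum>d=1..D. x ^ D / (1 - x))"
  proof (rule order.trans[OF sum_abs sum_mono])
    fix d assume d: "d \<in> {1..D}"
    have "d * (D div d) + D mod d = D" "D mod d < d" using d by simp_all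
    then have "D \<le> d * (D div d) + d" by linarith
    then have "x ^ (d * (D div d) + d) \<le> x ^ D" using x by (intro power_decreasing) auto
    moreover have "x ^ d \<le> x ^ 1" using x d by (intro power_decreasing) auto
    ultimately have "x ^ (d * (D div d) + d) / (1 - x ^ d) \<le> x ^ D / (1 - x)"
      using x pow_less[of d] d by (intro frac_le) auto
    moreover have "0 \<le> x ^ (d * (D div d) + d) / (1 - x ^ d)" using x pow_less[of d] d by simp
    ultimately show "\<bar>\<eta> d * (x ^ (d * (D div d) + d) / (1 - x ^ d))\<bar> \<le> x ^ D / (1 - x)"
      using mult_mono[OF abs_le[of d], of "x ^ (d * (D div d) + d) / (1 - x ^ d)" "x ^ D / (1 - x)"]
      by (simp only: abs_mult abs_of_nonneg mult_1_left zero_le_one)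
  qed
  also have "(\<Sum>d=1..D. x ^ D / (1 - x)) = real D * x ^ D / (1 - x)" by simp
  finally show ?thesis using lambert_bound[OF x L, of D] by linarith
qed

text \<open>First \<open>D\<close> tends to infinity with \<open>x\<close> and \<open>T\<close>
  fixed, then \<open>x\<close> tends to 1 from below with \<open>T\<close> fixed. This leaves
  \<open>T \<le> 2 * k\<close> for every \<open>T\<close>.\<close>

theorem L_nonzero: "L \<noteq> 0"
proof
  assume L: "L = 0"
  have bound: "(\<Sum>m=1..T. x ^ m\<^sup>2) \<le> 2 * k" if x: "0 < x" "x < 1" for x :: real and T :: nat
  proof (rule tendsto_lowerbound)
    have "(\<lambda>D. real D * x ^ D) \<longlonglongrightarrow> 0"
      using powser_times_n_limit_0[of x] x by simp
    then have "(\<lambda>D. 2 * k + 2 * k / (1 - x) * inverse (real (Suc D)) + real D * x ^ D / (1 - x)) \<longlonglongrightarrow> 2 * k + 2 * k / (1 - x) * 0 + 0 / (1 - x)"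
      using x by (intro tendsto_intros LIMSEQ_inverse_real_of_nat) auto
    then show "(\<lambda>D. 2 * k + 2 * k / ((1 - x) * (real D + 1)) + real D * x ^ D / (1 - x)) \<longlonglongrightarrow> real (2 * k)"
      by (simp add: divide_inverse mult_ac add_ac)
    show "\<forall>\<^sub>F D in sequentially. (\<Sum>m=1..T. x ^ m\<^sup>2) \<le> 2 * k + 2 * k / ((1 - x) * (real D + 1)) + real D * x ^ D / (1 - x)"
      using theta_bound[OF x L] by (auto simp: eventually_sequentially)
  qed simp
  have "(\<Sum>m=1..T. (1::real) ^ m\<^sup>2) \<le> 2 * k" for T :: nat
  proof (rule tendsto_upperbound)
    show "((\<lambda>x::real. \<Sum>m=1..T. x ^ m\<^sup>2) \<longlongrightarrow> (\<Sum>m=1..T. 1 ^ m\<^sup>2)) (at_left 1)"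
      by (intro tendsto_intros)
    show "\<forall>\<^sub>F x in at_left (1::real). (\<Sum>m=1..T. x ^ m\<^sup>2) \<le> real (2 * k)"
      using eventually_at_left_real[of 0 1] bound by (auto elim!: eventually_mono)
  qed simp
  from this[of "2 * k + 1"] show False by simp
qed

end

section \<open>Sums of the von Mangoldt function\<close>

abbreviation mangoldt_real :: "nat \<Rightarrow> real" ("\<Lambda>") where "mangoldt_real \<equiv> mangoldt"

lemma ln_fact_eq_sum_mangoldt: "ln (fact X :: real) = (\<Sum>d=1..X. \<Lambda> d * (X div d))"
proof -
  have "ln (fact X :: real) = (\<Sum>n=1..X. ln (real n))"
    by (subst ln_prod[symmetric]) (auto simp: fact_prod)
  also have "\<dots> = (\<Sum>n=1..X. \<Sum>d | d dvd n. \<Lambda> d)"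
    by (intro sum.cong refl) (simp add: mangoldt_sum)
  also have "\<dots> = (\<Sum>d=1..X. \<Sum>j=1..X div d. \<Lambda> d)" by (rule sum_sum_divisors)
  also have "\<dots> = (\<Sum>d=1..X. \<Lambda> d * (X div d))" by (simp add: mult.commute)
  finally show ?thesis .
qed

lemma fact_double_le: "(fact (2 * X) :: real) \<le> 4 ^ X * (fact X * fact X)"
proof -
  have "2 * X choose X \<le> (\<Sum>i\<le>2 * X. 2 * X choose i)" by (intro member_le_sum) auto
  then have "2 * X choose X \<le> 4 ^ X" by (simp add: choose_row_sum power_mult)
  then have "real (2 * X choose X) \<le> 4 ^ X" by (metis of_nat_le_iff of_nat_power of_nat_numeral)
  moreover have "fact (2 * X) = (fact X * fact X) * real (2 * X choose X)"
    using arg_cong[OF binomial_fact_lemma[of X "2 * X"], of real] by simp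
  ultimately show ?thesis by (simp add: mult.commute mult_left_mono)
qed

text \<open>Chebyshev's argument: in the logarithm of the central binomial coefficient
  \<open>\<Lambda> d\<close> has the coefficient \<open>2 * X div d - 2 * (X div d)\<close>, which
  is nonnegative, and at least 1 for \<open>X < d \<le> 2 * X\<close>.\<close>

lemma sum_mangoldt_double: "(\<Sum>d=1..2 * X. \<Lambda> d) \<le> (\<Sum>d=1..X. \<Lambda> d) + 2 * ln 2 * X"
proof -
  have "ln (fact (2 * X) :: real) \<le> ln (4 ^ X * (fact X * fact X))"
    by (subst ln_le_cancel_iff) (auto simp: fact_double_le)
  also have "\<dots> = X * ln 4 + 2 * ln (fact X)" by (simp add: ln_mult ln_realpow)
  also have "ln (4::real) = 2 * ln 2" using ln_realpow[of "2::real" 2] by simp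
  finally have le: "ln (fact (2 * X) :: real) - 2 * ln (fact X) \<le> 2 * ln 2 * real X" by (simp add: algebra_simps)
  have "ln (fact X :: real) = (\<Sum>d=1..2 * X. \<Lambda> d * (X div d))"
    unfolding ln_fact_eq_sum_mangoldt by (rule sum.mono_neutral_left) auto
  then have "ln (fact (2 * X)) - 2 * ln (fact X :: real) =
      (\<Sum>d=1..2 * X. \<Lambda> d * (real (2 * X div d) - 2 * real (X div d)))"
    unfolding ln_fact_eq_sum_mangoldt[of "2 * X"]
    by (simp add: sum_distrib_left algebra_simps flip: sum_subtractf)
  also have "\<dots> \<ge> (\<Sum>d=1..2 * X. \<Lambda> d * (if d \<le> X then 0 else 1))"
  proof (intro sum_mono mult_left_mono)
    fix d assume d: "d \<in> {1..2 * X}"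
    have "2 * (X div d) \<le> 2 * X div d"
      using d div_times_less_eq_dividend[of X d] by (simp add: less_eq_div_iff_mult_less_eq mult.assoc)
    then have "2 * real (X div d) \<le> real (2 * X div d)" by (metis of_nat_le_iff of_nat_mult of_nat_numeral)
    moreover have "X div d = 0" "2 * X div d \<ge> 1" if "\<not> d \<le> X"
      using that d by (auto simp: Suc_le_eq div_greater_zero_iff)
    ultimately show "(if d \<le> X then 0 else 1) \<le> real (2 * X div d) - 2 * real (X div d)" by simp
  qed (rule mangoldt_nonneg)
  also have "(\<Sum>d=1..2 * X. \<Lambda> d * (if d \<le> X then 0 else 1)) = (\<Sum>d=1..2 * X. \<Lambda> d - (if d \<le> X then \<Lambda> d else 0))"
    by (intro sum.cong) auto
  also have "\<dots> = (\<Sum>d=1..2 * X. \<Lambda> d) - (\<Sum>d=1..2 * X. if d \<le> X then \<Lambda> d else 0)"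
    by (rule sum_subtractf)
  also have "(\<Sum>d=1..2 * X. if d \<le> X then \<Lambda> d else 0) = (\<Sum>d=1..X. \<Lambda> d)"
    by (rule sum.mono_neutral_cong_right) auto
  finally show ?thesis using le by linarith
qed

lemma sum_mangoldt_le: "(\<Sum>d=1..X. \<Lambda> d) \<le> 6 * ln 2 * X"
proof (induction X rule: less_induct)
  case (less X)
  show ?case
  proof (cases "X \<le> 1")
    case True
    then have "(\<Sum>d=1..X. \<Lambda> d) = 0" by (intro sum.neutral) (auto simp: le_Suc_eq)
    then show ?thesis by simp
  next
    case False
    \<comment> \<open>Halving is rounded up; the constant 6 absorbs this, since 6 + 2 = 8 and
      \<open>4 * Y \<le> 3 * X\<close> for \<open>X \<ge> 2\<close>.\<close>
    define Y where "Y = (X + 1) div 2"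
    have Y: "Y < X" "X \<le> 2 * Y" "3 * Y + Y \<le> 3 * X" using False by (auto simp: Y_def)
    have "(\<Sum>d=1..X. \<Lambda> d) \<le> (\<Sum>d=1..2 * Y. \<Lambda> d)"
      using Y by (intro sum_mono2) (auto simp: mangoldt_nonneg)
    also have "\<dots> \<le> 6 * ln 2 * Y + 2 * ln 2 * Y"
      using sum_mangoldt_double[of Y] less.IH[OF Y(1)] by linarith
    also have "\<dots> = 2 * ln 2 * real (3 * Y + Y)" by (simp add: algebra_simps)
    also have "\<dots> \<le> 2 * ln 2 * real (3 * X)" using Y(3) by (intro mult_left_mono) (simp_all only: of_nat_le_iff, simp)
    finally show ?thesis by simp
  qed
qed

text \<open>The lower half of Mertens' estimate: one term of the exponential series gives
  \<open>X ^ X / fact X \<le> exp X\<close>, and dropping the floors in the formula for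
  \<open>ln (fact X)\<close> only enlarges the sum.\<close>

lemma sum_mangoldt_over_n_ge:
  assumes "X > 0"
  shows "(\<Sum>d=1..X. \<Lambda> d / d) \<ge> ln X - 1"
proof -
  have "real X ^ X / fact X \<le> exp (real X)"
  proof -
    have s: "(\<lambda>n. real X ^ n / fact n) sums exp (real X)"
      using exp_converges[of "real X"] by (simp add: divide_inverse mult.commute)
    have "(\<Sum>n\<in>{X}. real X ^ n / fact n) \<le> (\<Sum>n. real X ^ n / fact n)"
      using s by (intro sum_le_suminf) (auto simp: sums_iff)
    then show ?thesis using s by (simp add: sums_iff)
  qed
  then have "ln (real X ^ X / fact X) \<le> ln (exp (real X))"
    using assms by (subst ln_le_cancel_iff) auto
  then have "X * ln X - X \<le> ln (fact X)" using assms by (simp add: ln_div ln_realpow)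
  also have "\<dots> \<le> (\<Sum>d=1..X. \<Lambda> d * (X / d))"
    unfolding ln_fact_eq_sum_mangoldt by (intro sum_mono mult_left_mono mangoldt_nonneg) (rule of_nat_div_le_of_nat)
  also have "\<dots> = X * (\<Sum>d=1..X. \<Lambda> d / d)" by (simp add: sum_distrib_left mult.commute)
  finally have "X * (ln X - 1) \<le> X * (\<Sum>d=1..X. \<Lambda> d / d)" by (simp add: algebra_simps)
  then show ?thesis using assms by simp
qed

section \<open>Boundedness of the twisted sums of the von Mangoldt function\<close>

context nontrivial_real_char
begin

lemma abs_sum_ln_le: "\<bar>\<Sum>n=1..X. \<eta> n * (ln n / n)\<bar> \<le> 1 + 2 * k"
proof -
  \<comment> \<open>The weight decreases only beyond e, so summation by parts starts at 3 and the
    first two terms are treated apart.\<close>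
  have "ln (real (Suc n)) / real (Suc n) \<le> ln n / n" if "n \<ge> 3" for n :: nat
    using that exp_le by (intro ln_x_over_x_mono) auto
  then have "\<bar>\<Sum>n=3..<Suc X. \<eta> n * (ln n / n)\<bar> \<le> 2 * k * (ln (real 3) / real 3)"
    by (intro abs_sum_mult_le) auto
  also have "\<dots> \<le> 2 * real k * 1" using ln_le_minus_one[of 3] mult_left_mono[of "ln 3" 3 "real k"] by simp
  finally have *: "\<bar>\<Sum>n=3..<Suc X. \<eta> n * (ln n / n)\<bar> \<le> 2 * k" by simp
  show ?thesis
  proof (cases "X \<ge> 2")
    case True
    have "{1..X} = {1, 2} \<union> {3..<Suc X}" using True by auto
    then have "(\<Sum>n=1..X. \<eta> n * (ln n / n)) = \<eta> 2 * (ln 2 / 2) + (\<Sum>n=3..<Suc X. \<eta> n * (ln n / n))"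
      by (simp add: sum.union_disjoint)
    moreover have "\<bar>\<eta> 2 * (ln 2 / 2)\<bar> \<le> 1 * 1"
      unfolding abs_mult using ln_le_minus_one[of 2] by (intro mult_mono abs_le) auto
    ultimately show ?thesis using * by linarith
  next
    case False
    then have "X = 0 \<or> X = 1" by auto
    then show ?thesis by auto
  qed
qed

text \<open>Writing \<open>ln n\<close> as a divisor sum of \<Lambda> makes the bounded sum of
  \<open>\<eta> n * (ln n / n)\<close> equal to the wanted sum times \<open>L\<close>, up to an
  error controlled by Chebyshev's bound. Division by \<open>L\<close> uses its nonvanishing.\<close>

theorem sum_mangoldt_bounded: "\<exists>C. \<forall>X. \<bar>\<Sum>d=1..X. \<eta> d * (\<Lambda> d / d)\<bar> \<le> C"
proof (intro exI allI)
  fix X :: nat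
  have "(\<Sum>n=1..X. \<eta> n * (ln n / n)) =
      (\<Sum>n=1..X. \<Sum>d | d dvd n. \<eta> d * (\<Lambda> d / d) * (\<eta> (n div d) / (n div d)))"
  proof (intro sum.cong refl)
    fix n assume n: "n \<in> {1..X}"
    have "\<eta> n * (ln n / n) = (\<Sum>d | d dvd n. \<eta> n * \<Lambda> d / n)"
      using n by (simp add: sum_distrib_left[symmetric] sum_divide_distrib[symmetric] mangoldt_sum)
    also have "\<dots> = (\<Sum>d | d dvd n. \<eta> d * (\<Lambda> d / d) * (\<eta> (n div d) / (n div d)))"
    proof (intro sum.cong refl)
      fix d assume "d \<in> {d. d dvd n}"
      then obtain e where "n = d * e" by auto
      with n show "\<eta> n * \<Lambda> d / n = \<eta> d * (\<Lambda> d / d) * (\<eta> (n div d) / (n div d))"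
        by (simp add: eta_mult field_simps)
    qed
    finally show "\<eta> n * (ln n / n) = \<dots>" .
  qed
  also have "\<dots> = (\<Sum>d=1..X. \<Sum>j=1..X div d. \<eta> d * (\<Lambda> d / d) * (\<eta> j / j))"
    by (rule sum_sum_divisors)
  also have "\<dots> = (\<Sum>d=1..X. \<eta> d * (\<Lambda> d / d) * L - \<eta> d * (\<Lambda> d / d) * (L - (\<Sum>j=1..X div d. \<eta> j / j)))"
    by (simp add: sum_distrib_left algebra_simps)
  also have "\<dots> = (\<Sum>d=1..X. \<eta> d * (\<Lambda> d / d)) * L -
      (\<Sum>d=1..X. \<eta> d * (\<Lambda> d / d) * (L - (\<Sum>j=1..X div d. \<eta> j / j)))"
    by (simp only: sum_subtractf sum_distrib_right)
  finally have eq: "(\<Sum>d=1..X. \<eta> d * (\<Lambda> d / d)) * L = (\<Sum>n=1..X. \<eta> n * (ln n / n)) +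
      (\<Sum>d=1..X. \<eta> d * (\<Lambda> d / d) * (L - (\<Sum>j=1..X div d. \<eta> j / j)))" by simp
  have "\<bar>\<Sum>d=1..X. \<eta> d * (\<Lambda> d / d) * (L - (\<Sum>j=1..X div d. \<eta> j / j))\<bar> \<le> (\<Sum>d=1..X. 2 * k / X * \<Lambda> d)"
  proof (rule order.trans[OF sum_abs sum_mono])
    fix d assume d: "d \<in> {1..X}"
    have "d * (X div d) + X mod d = X" "X mod d < d" using d by simp_all
    \<comment> \<open>This turns the tail error \<open>2 * k / (X div d + 1)\<close> into
      \<open>2 * k * d / X\<close>; its factor \<open>d\<close> cancels the denominator of
      \<open>\<Lambda> d / d\<close>.\<close>
    then have "X \<le> d * (X div d + 1)" unfolding distrib_left by linarith
    then have "real X \<le> real d * (real (X div d) + 1)" by (metis of_nat_1 of_nat_add of_nat_le_iff of_nat_mult)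
    then have "2 * real k * X \<le> 2 * real k * (real d * (real (X div d) + 1))"
      by (intro mult_left_mono) auto
    then have "2 * k / (real (X div d) + 1) \<le> 2 * k * d / X"
      using d by (simp add: field_simps)
    then have "\<bar>L - (\<Sum>j=1..X div d. \<eta> j / j)\<bar> \<le> 2 * k * d / X"
      using abs_L_diff_le[of "X div d"] by linarith
    then have "\<bar>\<eta> d * (\<Lambda> d / d) * (L - (\<Sum>j=1..X div d. \<eta> j / j))\<bar> \<le> 1 * (\<Lambda> d / d) * (2 * k * d / X)"
      unfolding abs_mult by (intro mult_mono abs_le) (auto simp: mangoldt_nonneg)
    then show "\<bar>\<eta> d * (\<Lambda> d / d) * (L - (\<Sum>j=1..X div d. \<eta> j / j))\<bar> \<le> 2 * k / X * \<Lambda> d"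
      using d by (simp add: field_simps)
  qed
  also have "\<dots> = 2 * k / X * (\<Sum>d=1..X. \<Lambda> d)" by (rule sum_distrib_left[symmetric])
  also have "\<dots> \<le> 2 * k / X * (6 * ln 2 * X)" by (intro mult_left_mono sum_mangoldt_le) auto
  also have "\<dots> \<le> 12 * ln 2 * k" by simp
  finally have "\<bar>(\<Sum>d=1..X. \<eta> d * (\<Lambda> d / d)) * L\<bar> \<le> (1 + 2 * k) + 12 * ln 2 * k"
    unfolding eq using abs_sum_ln_le[of X] by linarith
  then show "\<bar>\<Sum>d=1..X. \<eta> d * (\<Lambda> d / d)\<bar> \<le> ((1 + 2 * k) + 12 * ln 2 * k) / \<bar>L\<bar>"
    using L_nonzero by (simp add: abs_mult pos_le_divide_eq)
qed

end

section \<open>Primes with prescribed quadratic characters\<close>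

lemma real_char_nonzero:
  assumes "real_char k \<eta>" "coprime n k"
  shows "\<eta> n \<noteq> 0"
proof
  assume z: "\<eta> n = 0"
  have pow: "\<eta> (n ^ i) = \<eta> n ^ i" for i
    using real_charD(1,4)[OF assms(1)] by (induction i) simp_all
  have "[n ^ totient k = 1] (mod k)" using assms(2) by (rule euler_theorem)
  then have "\<eta> (n ^ totient k) = \<eta> 1"
    unfolding cong_def using real_char_mod[OF assms(1)] by metis
  then have "totient k = 0" using pow[of "totient k"] z real_charD(4)[OF assms(1)]
    by (metis power_0_left zero_neq_one)
  then have "k = 0" by simp
  with assms(2) z real_charD(4)[OF assms(1)] show False by simp
qed

lemma real_char_mult:
  assumes "real_char k \<eta>" "real_char k \<theta>"
  shows "real_char k (\<lambda>n. \<eta> n * \<theta> n)"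
proof -
  have "\<eta> n * \<theta> n \<in> {-1, 0, 1}" for n
    using real_charD(3)[OF assms(1), of n] real_charD(3)[OF assms(2), of n] by auto
  then show ?thesis using assms by (simp add: real_char_def)
qed

lemma real_char_prod:
  assumes "finite S" "\<And>i. i \<in> S \<Longrightarrow> real_char k (\<eta> i)"
  shows "real_char k (\<lambda>n. \<Prod>i\<in>S. \<eta> i n)"
  using assms
proof (induction S rule: finite_induct)
  case (insert i S)
  then have "real_char k (\<eta> i)" "real_char k (\<lambda>n. \<Prod>i\<in>S. \<eta> i n)" by simp_all
  then show ?case using insert.hyps real_char_mult by simp
qed (auto simp: real_char_def)

text \<open>The logarithm is bounded by a small power of its argument. Any exponent below 1/2 would
  leave a summable power of \<open>m\<close>; 1/4 gives -3/2.\<close>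

lemma mangoldt_over_square_le:
  assumes "c > 0" "m > 0"
  shows "\<Lambda> (c * m\<^sup>2) / real (c * m\<^sup>2) \<le> 4 * real m powr (-3/2)"
proof -
  define y where "y = real (c * m\<^sup>2)"
  have "m\<^sup>2 \<le> c * m\<^sup>2" using assms by simp
  then have m: "real m ^ 2 \<le> y" unfolding y_def by (metis of_nat_le_iff of_nat_power)
  have "1 \<le> c * m\<^sup>2" using assms by simp
  then have y: "y \<ge> 1" unfolding y_def by linarith
  have "\<Lambda> (c * m\<^sup>2) \<le> ln y" unfolding y_def using assms by (intro mangoldt_le) auto
  also have "\<dots> \<le> y powr (1/4) / (1/4)" using y by (intro ln_powr_bound) auto
  finally have "\<Lambda> (c * m\<^sup>2) / y \<le> 4 * y powr (1/4) / y" using y by (intro divide_right_mono) auto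
  also have "\<dots> = 4 * y powr (-3/4)" using y powr_diff[of y "1/4" 1] by simp
  also have "\<dots> \<le> 4 * (real m ^ 2) powr (-3/4)"
    using m assms by (intro mult_left_mono powr_mono2') auto
  also have "\<dots> = 4 * real m powr (-3/2)"
    using assms powr_powr[of "real m" 2 "-3/4"] by simp
  finally show ?thesis unfolding y_def .
qed

text \<open>
  The weight \<open>g n\<close> is positive only if no character takes the value \<open>- \<epsilon> i\<close> at \<open>n\<close>. If the required
  prime did not exist, every prime power with nonzero weight would be of the form \<open>c m\<^sup>2\<close>
  with \<open>c \<le> k\<close>, and \<open>\<Sum> g n * \<Lambda> n / n\<close> would converge; but expanding the product \<open>g\<close> shows that its
  partial sums are at least \<open>ln X\<close> up to a constant.
\<close>

theorem prime_with_prescribed_characters: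
  fixes \<eta> :: "'i \<Rightarrow> nat \<Rightarrow> real" and \<epsilon> :: "'i \<Rightarrow> real"
  assumes I: "finite I" and k: "k > 0" and char: "\<And>i. i \<in> I \<Longrightarrow> real_char k (\<eta> i)"
    and indep: "\<And>i. i \<in> I \<Longrightarrow> \<exists>a. coprime a k \<and> \<eta> i a = -1 \<and> (\<forall>j\<in>I - {i}. \<eta> j a = 1)"
    and \<epsilon>: "\<And>i. i \<in> I \<Longrightarrow> \<epsilon> i \<in> {-1, 1}"
  shows "\<exists>p. prime p \<and> (\<forall>i\<in>I. \<eta> i p = \<epsilon> i)"
proof (rule ccontr)
  assume no_prime: "\<not> ?thesis"
  define g where "g n = (\<Prod>i\<in>I. \<epsilon> i * \<eta> i n + 1)" for n
  define G where "G X = (\<Sum>n=1..X. g n * (\<Lambda> n / n))" for X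
  have factor: "0 \<le> \<epsilon> i * \<eta> i n + 1" "\<epsilon> i * \<eta> i n + 1 \<le> 2" if "i \<in> I" for i n
    using \<epsilon>[OF that] real_charD(3)[OF char[OF that], of n] by auto
  have g_nonneg: "g n \<ge> 0" for n
    unfolding g_def using factor by (intro prod_nonneg)
  have g_le: "g n \<le> 2 ^ card I" for n
  proof -
    have "g n \<le> (\<Prod>i\<in>I. 2)" unfolding g_def using factor by (intro prod_mono) simp
    then show ?thesis by simp
  qed

  \<comment> \<open>The independence hypothesis for one \<open>i\<close> in \<open>S\<close>
    supplies a unit at which the whole product is -1, so every nonempty product is nontrivial. Only
    the empty product contributes \<open>ln X\<close>.\<close>
  have "\<exists>C. \<forall>X. \<bar>\<Sum>n=1..X. (\<Prod>i\<in>S. \<eta> i n) * (\<Lambda> n / n)\<bar> \<le> C" if S: "S \<in> Pow I - {{}}" for S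
  proof -
    from S obtain i where i: "i \<in> S" "i \<in> I" by auto
    obtain a where a: "coprime a k" "\<eta> i a = -1" "\<forall>j\<in>I - {i}. \<eta> j a = 1" using indep[OF i(2)] by auto
    have "finite S" using S I finite_subset by auto
    have "(\<Prod>j\<in>S. \<eta> j a) = \<eta> i a * (\<Prod>j\<in>S - {i}. \<eta> j a)" using i \<open>finite S\<close> by (simp add: prod.remove)
    also have "(\<Prod>j\<in>S - {i}. \<eta> j a) = 1" using a S by (intro prod.neutral) auto
    finally have "(\<Prod>j\<in>S. \<eta> j a) = -1" using a by simp
    moreover have rc: "real_char k (\<lambda>n. \<Prod>i\<in>S. \<eta> i n)" using S char \<open>finite S\<close> by (intro real_char_prod) auto
    ultimately interpret nontrivial_real_char k "\<lambda>n. \<Prod>i\<in>S. \<eta> i n"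
      using k a(1) by unfold_locales (auto intro: real_char_sum_period)
    show ?thesis using sum_mangoldt_bounded .
  qed
  then obtain C where C: "\<And>S X. S \<in> Pow I - {{}} \<Longrightarrow> \<bar>\<Sum>n=1..X. (\<Prod>i\<in>S. \<eta> i n) * (\<Lambda> n / n)\<bar> \<le> C S"
    by metis
  have lower: "G X \<ge> ln X - 1 - (\<Sum>S\<in>Pow I - {{}}. C S)" if "X > 0" for X
  proof -
    define F where "F S = (\<Prod>i\<in>S. \<epsilon> i) * (\<Sum>n=1..X. (\<Prod>i\<in>S. \<eta> i n) * (\<Lambda> n / n))" for S
    have "g n * (\<Lambda> n / n) = (\<Sum>S\<in>Pow I. (\<Prod>i\<in>S. \<epsilon> i) * ((\<Prod>i\<in>S. \<eta> i n) * (\<Lambda> n / n)))" for n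
      unfolding g_def prod_add[OF I] sum_distrib_right by (simp add: prod.distrib mult.assoc)
    then have "G X = (\<Sum>n=1..X. \<Sum>S\<in>Pow I. (\<Prod>i\<in>S. \<epsilon> i) * ((\<Prod>i\<in>S. \<eta> i n) * (\<Lambda> n / n)))"
      unfolding G_def by (simp only:)
    also have "\<dots> = (\<Sum>S\<in>Pow I. F S)"
      unfolding F_def sum_distrib_left by (rule sum.swap)
    also have "\<dots> = F {} + (\<Sum>S\<in>Pow I - {{}}. F S)"
      using I by (intro sum.remove) auto
    also have "\<dots> \<ge> (ln X - 1) + (\<Sum>S\<in>Pow I - {{}}. - C S)"
    proof (intro add_mono sum_mono)
      show "ln X - 1 \<le> F {}" using sum_mangoldt_over_n_ge[OF that] by (simp add: F_def)
    next
      fix S assume S: "S \<in> Pow I - {{}}"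
      have "\<bar>\<Prod>i\<in>S. \<epsilon> i\<bar> = 1" unfolding abs_prod using S \<epsilon> by (intro prod.neutral) force
      then have "\<bar>F S\<bar> \<le> C S"
        unfolding F_def abs_mult using C[OF S, of X] by simp
      then show "- C S \<le> F S" by linarith
    qed
    finally show ?thesis by (simp add: sum_negf)
  qed

  have shape: "\<exists>c\<in>{1..k}. \<exists>m\<in>{1..X}. n = c * m\<^sup>2" if n: "n \<in> {1..X}" and nz: "g n * (\<Lambda> n / n) \<noteq> 0" for n X
  proof -
    from nz have "primepow n" by (auto simp: mangoldt_def split: if_splits)
    then obtain p j where p: "prime p" "j > 0" "n = p ^ j" by (auto simp: primepow_def)
    have "p \<ge> 1" using p(1) prime_ge_1_nat by blast
    then have "p ^ (j div 2) \<le> p ^ j" "p ^ (j div 2) \<ge> 1" by (auto intro: power_increasing)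
    then have m: "p ^ (j div 2) \<in> {1..X}" using n p(3) by auto
    show ?thesis
    proof (cases "even j")
      case True
      then have "n = 1 * (p ^ (j div 2))\<^sup>2" using p by (simp add: power_mult[symmetric])
      with m k show ?thesis by force
    next
      case False
      then have "Suc (j div 2 * 2) = j" by presburger
      then have "n = p ^ Suc (j div 2 * 2)" using p(3) by metis
      then have n_eq: "n = p * (p ^ (j div 2))\<^sup>2" by (simp add: power_mult)
      obtain i where i: "i \<in> I" "\<eta> i p \<noteq> \<epsilon> i" using no_prime p by auto
      have pw: "\<eta> i (p ^ j) = \<eta> i p ^ j" for j
        using real_charD(1,4)[OF char[OF i(1)]] by (induction j) simp_all
      \<comment> \<open>For odd \<open>j\<close> the values of \<open>\<eta> i\<close> at
        \<open>n\<close> and \<open>p\<close> agree. The nonzero weight excludes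
        \<open>- \<epsilon> i\<close> and the choice of \<open>i\<close> excludes
        \<open>\<epsilon> i\<close>; the remaining value 0 forces \<open>p\<close> to divide
        \<open>k\<close>.\<close>
      have "\<epsilon> i * \<eta> i n + 1 \<noteq> 0" using nz i I by (auto simp: g_def)
      moreover have "\<eta> i p \<in> {-1, 0, 1}" "\<epsilon> i \<in> {-1, 1}" using real_charD(3)[OF char[OF i(1)]] \<epsilon> i by blast+
      ultimately have "\<eta> i p = 0" using i False pw[of j] p(3) by auto
      then have "p dvd k" using real_char_nonzero[OF char[OF i(1)], of p] prime_imp_coprime[OF p(1)] by blast
      then have "p \<in> {1..k}" using k \<open>p \<ge> 1\<close> by (auto dest: dvd_imp_le)
      with m n_eq show ?thesis by blast
    qed
  qed
  define B where "B = (\<Sum>m. 4 * real m powr (-3/2))"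
  have upper: "G X \<le> 2 ^ card I * (k * B)" for X
  proof -
    let ?f = "\<lambda>(c, m). c * m\<^sup>2 :: nat" and ?D = "{1..k} \<times> {1..X}"
    have "G X \<le> (\<Sum>n\<in>?f ` ?D. 2 ^ card I * (\<Lambda> n / n))"
    proof -
      have "G X = (\<Sum>n\<in>{1..X} \<inter> ?f ` ?D. g n * (\<Lambda> n / n))"
        unfolding G_def
      proof (intro sum.mono_neutral_right ballI)
        fix n assume n: "n \<in> {1..X} - {1..X} \<inter> ?f ` ?D"
        show "g n * (\<Lambda> n / n) = 0"
        proof (rule ccontr)
          assume "g n * (\<Lambda> n / n) \<noteq> 0"
          then obtain c m where "c \<in> {1..k}" "m \<in> {1..X}" "n = c * m\<^sup>2" using shape n by blast
          then have "n \<in> ?f ` ?D" by force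
          with n show False by blast
        qed
      qed auto
      also have "\<dots> \<le> (\<Sum>n\<in>{1..X} \<inter> ?f ` ?D. 2 ^ card I * (\<Lambda> n / n))"
        by (intro sum_mono mult_right_mono g_le) (simp add: mangoldt_nonneg)
      also have "\<dots> \<le> (\<Sum>n\<in>?f ` ?D. 2 ^ card I * (\<Lambda> n / n))"
        by (intro sum_mono2) (auto simp: mangoldt_nonneg)
      finally show ?thesis .
    qed
    also have "\<dots> \<le> (\<Sum>x\<in>?D. 2 ^ card I * (\<Lambda> (?f x) / ?f x))"
      using sum_image_le[of ?D "\<lambda>n. 2 ^ card I * (\<Lambda> n / n)" ?f] by (simp add: mangoldt_nonneg)
    also have "\<dots> = 2 ^ card I * (\<Sum>c=1..k. \<Sum>m=1..X. \<Lambda> (c * m\<^sup>2) / real (c * m\<^sup>2))"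
      unfolding sum_distrib_left sum.cartesian_product by (intro sum.cong) auto
    also have "\<dots> \<le> 2 ^ card I * (\<Sum>c=1..k. B)"
    proof (intro mult_left_mono sum_mono)
      fix c assume "c \<in> {1..k}"
      then have "(\<Sum>m=1..X. \<Lambda> (c * m\<^sup>2) / real (c * m\<^sup>2)) \<le> (\<Sum>m=1..X. 4 * real m powr (-3/2))"
        by (intro sum_mono mangoldt_over_square_le) auto
      also have "\<dots> \<le> B" unfolding B_def
        by (intro sum_le_suminf summable_mult) (auto simp: summable_real_powr_iff)
      finally show "(\<Sum>m=1..X. \<Lambda> (c * m\<^sup>2) / real (c * m\<^sup>2)) \<le> B" .
    qed auto
    finally show ?thesis by simp
  qed
  define K where "K = 2 ^ card I * (k * B) + 1 + (\<Sum>S\<in>Pow I - {{}}. C S)"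
  have "ln X \<le> K" if "X > 0" for X :: nat
    using lower[OF that] upper[of X] unfolding K_def by linarith
  moreover obtain X :: nat where "exp (K + 1) < X" using reals_Archimedean2 by blast
  moreover from this have "X > 0" by (metis exp_gt_zero of_nat_0_less_iff order.strict_trans)
  ultimately have "exp (ln X) \<le> exp K" "exp (K + 1) < exp (ln X)" by (simp_all only: exp_le_cancel_iff) simp_all
  then show False by simp
qed

section \<open>Legendre symbols as real characters\<close>

lemma Legendre_values: "Legendre a p \<in> {-1, 0, 1}"
  by (simp add: Legendre_def)

lemma Legendre_cong:
  assumes "[a = b] (mod p)"
  shows "Legendre a p = Legendre b p"
proof -
  have "[a = 0] (mod p) \<longleftrightarrow> [b = 0] (mod p)" using assms by (metis cong_sym cong_trans)
  moreover have "QuadRes p a \<longleftrightarrow> QuadRes p b"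
    unfolding QuadRes_def using assms by (metis cong_sym cong_trans)
  ultimately show ?thesis by (simp add: Legendre_def)
qed

lemma Legendre_mult:
  fixes p :: nat
  assumes "prime p" "p > 2"
  shows "Legendre (a * b) p = Legendre a p * Legendre b p"
proof -
  have "[Legendre (a * b) p = (a * b) ^ ((p - 1) div 2)] (mod p)"
    by (rule euler_criterion[OF assms])
  moreover have "[Legendre a p * Legendre b p = (a * b) ^ ((p - 1) div 2)] (mod p)"
    unfolding power_mult_distrib by (intro cong_mult euler_criterion assms)
  ultimately have "[Legendre (a * b) p = Legendre a p * Legendre b p] (mod p)"
    using cong_sym cong_trans by blast
  then have "int p dvd Legendre (a * b) p - Legendre a p * Legendre b p"
    by (simp add: cong_iff_dvd_diff)
  moreover have "\<bar>Legendre (a * b) p - Legendre a p * Legendre b p\<bar> < int p"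
    using Legendre_values[of "a * b" p] Legendre_values[of a p] Legendre_values[of b p] assms(2) by auto
  ultimately have "Legendre (a * b) p - Legendre a p * Legendre b p = 0"
    using zdvd_not_zless[of "\<bar>Legendre (a * b) p - Legendre a p * Legendre b p\<bar>" "int p"] by force
  then show ?thesis by simp
qed

lemma Legendre_eq_0_iff: "Legendre a p = 0 \<longleftrightarrow> p dvd a"
  by (simp add: Legendre_def cong_0_iff)

lemma Legendre_eq_1_iff: "Legendre a p = 1 \<longleftrightarrow> \<not> p dvd a \<and> QuadRes p a"
  by (simp add: Legendre_def cong_0_iff)

lemma Legendre_1: "prime p \<Longrightarrow> Legendre 1 (int p) = 1"
proof -
  assume "prime p"
  then have "\<not> int p dvd 1" using prime_gt_1_nat by force
  moreover have "QuadRes p 1" unfolding QuadRes_def by (rule exI[of _ 1]) simp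
  ultimately show ?thesis by (simp add: Legendre_eq_1_iff)
qed

text \<open>Squaring identifies 1 and \<open>p - 1\<close>, so on the finite set of nonzero residues
  it is not injective, hence not surjective.\<close>

lemma ex_nonresidue:
  fixes p :: nat
  assumes "prime p" "p > 2"
  shows "\<exists>a::nat. Legendre a p = -1"
proof -
  let ?f = "\<lambda>x. x\<^sup>2 mod p"
  have "\<not> inj_on ?f {1..<p}"
  proof
    assume inj: "inj_on ?f {1..<p}"
    obtain m where "p = m + 2" using assms(2) by (metis add.commute le_Suc_ex less_imp_le)
    then have "(p - 1)\<^sup>2 = p * m + 1" by (simp add: power2_eq_square)
    then have "?f (p - 1) = 1 mod p" by (metis mod_mult_self4)
    then have "?f 1 = ?f (p - 1)" by simp
    then have "1 = p - 1" by (rule inj_onD[OF inj]) (use assms(2) in auto)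
    then show False using assms(2) by simp
  qed
  then have "\<not> {1..<p} \<subseteq> ?f ` {1..<p}" using finite_surj_inj[of "{1..<p}" ?f] by auto
  then obtain a where a: "a \<in> {1..<p}" "a \<notin> ?f ` {1..<p}" by (meson subsetI)
  have "\<not> QuadRes p a"
  proof
    assume "QuadRes p a"
    then obtain y where y: "[y\<^sup>2 = int a] (mod p)" by (auto simp: QuadRes_def)
    define x where "x = nat (y mod p)"
    have x: "int x = y mod p" using assms(2) by (simp add: x_def)
    then have "[(int x)\<^sup>2 = y\<^sup>2] (mod p)" by (intro cong_pow) (simp add: cong_def)
    then have "[int (x\<^sup>2) = int a] (mod p)" using y by (metis cong_trans of_nat_power)
    then have sq: "[x\<^sup>2 = a] (mod p)" by (simp only: cong_int_iff)
    then have fx: "?f x = a" using a by (simp add: cong_def)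
    then have "x \<noteq> 0" using a by (intro notI) auto
    moreover have "int x < int p" unfolding x using assms(2) by simp
    ultimately show False using a fx by force
  qed
  moreover have "\<not> int p dvd int a" using a by (auto dest: dvd_imp_le)
  ultimately have "Legendre a p = -1" by (simp add: Legendre_def cong_0_iff)
  then show ?thesis ..
qed

lemma Legendre_2:
  fixes p :: nat
  assumes "prime p" "p mod 4 = 1"
  shows "Legendre 2 p = (if p mod 8 = 1 then 1 else -1)"
proof -
  define h where "h = p div 4"
  have p: "p = 4 * h + 1" using assms(2) unfolding h_def by presburger
  have "p > 2" using prime_gt_1_nat[OF assms(1)] p by (cases "h = 0") auto
  interpret GAUSS p 2
    using assms \<open>p > 2\<close> by unfold_locales (auto simp: cong_def)
  \<comment> \<open>Gauss's lemma counts the doubled residues beyond \<open>2 * h\<close>; these are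
    the \<open>2 * x\<close> with \<open>h < x \<le> 2 * h\<close>, exactly \<open>h\<close> of
    them.\<close>
  have half: "(int p - 1) div 2 = 2 * int h" using p by simp
  have "C = (\<lambda>x. x * 2) ` A"
    unfolding C_def B_def image_image
    by (intro image_cong refl mod_pos_pos_trivial) (unfold A_def half, insert p, auto)
  then have "E = (\<lambda>x. x * 2) ` {int h <.. 2 * int h}"
    unfolding E_def A_def half by auto
  then have "card E = h" by (simp add: card_image inj_on_def)
  then have "Legendre 2 p = (-1) ^ h" using gauss_lemma by simp
  moreover have "even h \<longleftrightarrow> p mod 8 = 1" unfolding p by presburger
  ultimately show ?thesis by simp
qed

lemma real_char_Legendre:
  fixes q :: nat
  assumes "prime q" "q > 2" "q dvd k"
  shows "real_char k (\<lambda>n. Legendre n q)"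
proof -
  have "Legendre (int (n + k)) q = Legendre n q" for n
    using assms(3) by (intro Legendre_cong) (simp add: cong_iff_dvd_diff)
  moreover have "real_of_int (Legendre n q) \<in> {-1, 0, 1}" for n
    using Legendre_values[of n q] by auto
  ultimately show ?thesis
    unfolding real_char_def using Legendre_mult[OF assms(1,2)] Legendre_1[OF assms(1)] by simp
qed

definition \<chi>4 :: "nat \<Rightarrow> real" where
  "\<chi>4 n = (if even n then 0 else if n mod 4 = 1 then 1 else -1)"

text \<open>This is the symbol (2/n). Together with \<open>\<chi>4 p = 1\<close> its value decides
  between the classes 1 and 5 modulo 8.\<close>

definition \<chi>8 :: "nat \<Rightarrow> real" where
  "\<chi>8 n = (if even n then 0 else if n mod 8 = 1 \<or> n mod 8 = 7 then 1 else -1)"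

lemma real_char_mod8:
  fixes f :: "nat \<Rightarrow> real"
  assumes "\<And>n. f (n mod 8) = f n" "\<And>m n. m < 8 \<Longrightarrow> n < 8 \<Longrightarrow> f (m * n) = f m * f n"
    "\<And>n. f n \<in> {-1, 0, 1}" "f 1 = 1" "8 dvd k"
  shows "real_char k f"
proof -
  have "f (m * n) = f m * f n" for m n
  proof -
    have "f (m * n) = f ((m mod 8) * (n mod 8))" by (metis assms(1) mod_mult_eq)
    then show ?thesis using assms(1,2) by simp
  qed
  moreover have "f (n + k) = f n" for n
    using assms(1)[of "n + k"] assms(1)[of n] assms(5) by (metis mod_add_right_eq add.right_neutral dvd_eq_mod_eq_0)
  ultimately show ?thesis using assms(3,4) by (simp add: real_char_def)
qed

lemma less_8_cases: "n < (8::nat) \<Longrightarrow> n \<in> {0,1,2,3,4,5,6,7}" by auto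

lemma real_char_\<chi>4: "8 dvd k \<Longrightarrow> real_char k \<chi>4"
proof (rule real_char_mod8)
  fix m n :: nat
  show "\<chi>4 (n mod 8) = \<chi>4 n" by (simp add: \<chi>4_def mod_mod_cancel dvd_mod_iff)
  show "\<chi>4 (m * n) = \<chi>4 m * \<chi>4 n" if "m < 8" "n < 8"
    using less_8_cases[OF that(1)] less_8_cases[OF that(2)]
    by (elim insertE emptyE; simp add: \<chi>4_def)
qed (auto simp: \<chi>4_def)

lemma real_char_\<chi>8: "8 dvd k \<Longrightarrow> real_char k \<chi>8"
proof (rule real_char_mod8)
  fix m n :: nat
  show "\<chi>8 (n mod 8) = \<chi>8 n" by (simp add: \<chi>8_def mod_mod_cancel dvd_mod_iff)
  show "\<chi>8 (m * n) = \<chi>8 m * \<chi>8 n" if "m < 8" "n < 8"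
    using less_8_cases[OF that(1)] less_8_cases[OF that(2)]
    by (elim insertE emptyE; simp add: \<chi>8_def)
qed (auto simp: \<chi>8_def)

lemma prime_with_prescribed_residues:
  fixes N :: nat and \<epsilon> :: "nat \<Rightarrow> int"
  assumes N: "odd N" "squarefree N" and \<epsilon>: "\<And>q. q \<in> prime_factors N \<Longrightarrow> \<epsilon> q \<in> {-1, 1}"
    and \<delta>: "\<delta> \<in> {-1, 1::int}"
  shows "\<exists>p::nat. prime p \<and> p mod 4 = 1 \<and> Legendre 2 p = \<delta> \<and> (\<forall>q\<in>prime_factors N. Legendre p q = \<epsilon> q)"
proof -
  \<comment> \<open>The indices 4 and 8 are labels that cannot collide with the primes dividing
    \<open>N\<close>.\<close>
  define \<eta> where "\<eta> i = (if i = 4 then \<chi>4 else if i = 8 then \<chi>8 else (\<lambda>n. Legendre n i))" for i :: nat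
  define I where "I = insert 4 (insert 8 (prime_factors N))"
  define e where "e i = (if i = 4 then 1 else if i = 8 then real_of_int \<delta> else \<epsilon> i)" for i :: nat
  have N0: "N > 0" using N by (intro Nat.gr0I) auto
  have q: "prime q" "q > 2" "q dvd N" "q \<noteq> 4" "q \<noteq> 8" if "q \<in> prime_factors N" for q
  proof -
    show pq: "prime q" "q dvd N" using that by auto
    then have "odd q" using N(1) dvd_trans by blast
    then show "q \<noteq> 4" "q \<noteq> 8" by auto
    show "q > 2" using \<open>odd q\<close> prime_gt_1_nat[OF pq(1)] by (cases "q = 2") auto
  qed
  have \<eta>_q: "\<eta> q n = Legendre n q" if "q \<in> prime_factors N" for q n
    using q[OF that] by (simp add: \<eta>_def)
  have \<eta>_q_cong1: "\<eta> q a = 1" if "q \<in> prime_factors N" "[a = 1] (mod m)" "q dvd m" for q a m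
  proof -
    have "[int a = 1] (mod q)"
      using that by (metis cong_dvd_modulus_nat cong_int_iff of_nat_1)
    then have "Legendre a q = Legendre 1 q" by (rule Legendre_cong)
    then show ?thesis using \<eta>_q[OF that(1)] Legendre_1 q(1)[OF that(1)] by simp
  qed
  have cop8: "coprime 8 N"
    using N(1) coprime_power_left_iff[of 2 3 N] by simp
  have "\<exists>p. prime p \<and> (\<forall>i\<in>I. \<eta> i p = e i)"
  proof (rule prime_with_prescribed_characters[where k = "8 * N"])
    show "finite I" by (simp add: I_def)
    show "8 * N > 0" using N0 by simp
    show "real_char (8 * N) (\<eta> i)" if "i \<in> I" for i
    proof -
      have "i = 4 \<or> i = 8 \<or> i \<in> prime_factors N" using that by (auto simp: I_def)
      then show ?thesis using q[of i]
        by (auto simp: \<eta>_def real_char_\<chi>4 real_char_\<chi>8 intro!: real_char_Legendre)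
    qed
    show "e i \<in> {-1, 1}" if "i \<in> I" for i
      using that \<epsilon>[of i] \<delta> by (auto simp: I_def e_def)
    show "\<exists>a. coprime a (8 * N) \<and> \<eta> i a = - 1 \<and> (\<forall>j\<in>I - {i}. \<eta> j a = 1)" if i: "i \<in> I" for i
    proof (cases "i \<in> prime_factors N")
      case True
      note qi = q[OF True]
      \<comment> \<open>The witness for independence is a nonresidue modulo \<open>i\<close> and 1
        modulo \<open>M\<close>; squarefreeness makes the two moduli coprime.\<close>
      define M where "M = 8 * (N div i)"
      obtain N' where N': "N = i * N'" using qi(3) by auto
      have "coprime i N'"
      proof (rule ccontr)
        assume "\<not> coprime i N'"
        then have "i dvd N'" using prime_imp_coprime qi(1) by blast
        then have "i\<^sup>2 dvd N" by (simp add: N' power2_eq_square)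
        then have "i dvd 1" by (rule squarefreeD[OF N(2)])
        then show False using qi(2) by simp
      qed
      moreover have "coprime i 8" using qi(3) cop8 coprime_divisors[of i N 8 8] by (simp add: coprime_commute)
      moreover have M: "M = 8 * N'" using N' qi(2) by (simp add: M_def)
      ultimately have "coprime i M" by simp
      obtain g :: nat where g: "Legendre g i = -1" using ex_nonresidue qi(1,2) by blast
      obtain a where a: "[a = g] (mod i)" "[a = 1] (mod M)"
        using binary_chinese_remainder_nat[OF \<open>coprime i M\<close>] by blast
      have "Legendre a i = -1" using Legendre_cong[of "int a" "int g" "int i"] g a(1) by (simp add: cong_int_iff)
      then have "\<not> int i dvd int a" using Legendre_eq_0_iff[of a i] by simp
      then have "coprime a i" using prime_imp_coprime[OF qi(1)] coprime_commute by auto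
      moreover have "coprime a M" using a(2) by (metis coprime_1_left cong_imp_coprime cong_sym)
      ultimately have "coprime a (8 * N)" by (simp add: N' M)
      moreover have "\<eta> i a = -1" using \<eta>_q[OF True] \<open>Legendre a i = -1\<close> by simp
      moreover have "\<eta> j a = 1" if j: "j \<in> I - {i}" for j
      proof -
        have "[a = 1] (mod 8)" using a(2) M by (metis cong_dvd_modulus_nat dvd_triv_left)
        then have "a mod 8 = 1" by (simp add: cong_def)
        moreover from this have "a mod 4 = 1" "odd a" by presburger+
        ultimately have "\<chi>4 a = 1" "\<chi>8 a = 1" by (auto simp: \<chi>4_def \<chi>8_def)
        moreover have "\<eta> j a = 1" if j': "j \<in> prime_factors N"
        proof (rule \<eta>_q_cong1[OF j' a(2)])
          have "j dvd i * N'" using j' N' by auto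
          moreover have "coprime j i" using j j' qi(1) q(1)[OF j'] by (intro primes_coprime) auto
          ultimately have "j dvd N'" by (simp add: coprime_dvd_mult_right_iff)
          then show "j dvd M" by (simp add: M)
        qed
        ultimately show ?thesis using j by (auto simp: I_def \<eta>_def)
      qed
      ultimately show ?thesis by blast
    next
      case False
      \<comment> \<open>Modulo 8, the class 7 has \<open>\<chi>4\<close> = -1 and
        \<open>\<chi>8\<close> = 1, and the class 5 has the opposite values.\<close>
      define r :: nat where "r = (if i = 4 then 7 else 5)"
      obtain a where a: "[a = r] (mod 8)" "[a = 1] (mod N)"
        using binary_chinese_remainder_nat[OF cop8] by blast
      have "a mod 8 = r" using a(1) by (simp add: cong_def r_def)
      then consider "i = 4" "a mod 8 = 7" | "i \<noteq> 4" "a mod 8 = 5" by (auto simp: r_def)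
      then have "odd a \<and> a mod 4 = (if i = 4 then 3 else 1)"
      proof cases
        case 1
        then have "odd a" "a mod 4 = 3" by presburger+
        with 1 show ?thesis by simp
      next
        case 2
        then have "odd a" "a mod 4 = 1" by presburger+
        with 2 show ?thesis by simp
      qed
      then have a8: "odd a" "a mod 4 = (if i = 4 then 3 else 1)" by blast+
      have "coprime a N" using a(2) by (metis coprime_1_left cong_imp_coprime cong_sym)
      moreover have "coprime a 8" using a8(1) coprime_power_right_iff[of a 2 3] by simp
      ultimately have "coprime a (8 * N)" by simp
      moreover have "i = 4 \<or> i = 8" using False i by (auto simp: I_def)
      then have "\<eta> i a = -1" "\<forall>j\<in>{4, 8} - {i}. \<eta> j a = 1"
        using a8 \<open>a mod 8 = r\<close> by (auto simp: \<eta>_def \<chi>4_def \<chi>8_def r_def)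
      moreover have "\<eta> j a = 1" if "j \<in> prime_factors N" for j
        using \<eta>_q_cong1[OF that a(2)] q(3)[OF that] by blast
      ultimately show ?thesis by (auto simp: I_def)
    qed
  qed
  then obtain p where p: "prime p" "\<forall>i\<in>I. \<eta> i p = e i" by blast
  have "\<chi>4 p = 1" "\<chi>8 p = \<delta>" using p(2) by (auto simp: I_def \<eta>_def e_def)
  then have p4: "p mod 4 = 1" by (auto simp: \<chi>4_def split: if_splits)
  have "p mod 8 \<noteq> 7" using p4 by presburger
  then have "Legendre 2 p = \<delta>" using \<open>\<chi>8 p = \<delta>\<close> \<delta> Legendre_2[OF p(1) p4]
    by (auto simp: \<chi>8_def split: if_splits)
  moreover have "Legendre p i = \<epsilon> i" if "i \<in> prime_factors N" for i
  proof -
    have "real_of_int (Legendre p i) = \<epsilon> i"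
      using p(2) that q(4,5)[OF that] \<eta>_q[OF that] by (auto simp: I_def e_def)
    then show ?thesis by simp
  qed
  ultimately show ?thesis using p p4 by blast
qed

section \<open>Sums of three squares\<close>

lemma QuadRes_squarefree:
  fixes N :: nat and a :: int
  assumes "squarefree N" and "\<And>q. q \<in> prime_factors N \<Longrightarrow> QuadRes q a"
  shows "QuadRes N a"
  using assms
proof (induction N rule: less_induct)
  case (less N)
  show ?case
  proof (cases "N = 1")
    case True
    then show ?thesis by (simp add: QuadRes_def)
  next
    case False
    then obtain q where q: "prime q" "q dvd N" using prime_factor_nat by blast
    then obtain M where M: "N = q * M" by auto
    have "N > 0" using less.prems(1) by (intro Nat.gr0I) auto
    have "coprime q M"
    proof (rule ccontr)
      assume "\<not> coprime q M"
      then have "q dvd M" using prime_imp_coprime q(1) by blast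
      then have "q\<^sup>2 dvd N" by (simp add: M power2_eq_square)
      then have "q dvd 1" by (rule squarefreeD[OF less.prems(1)])
      then show False using q(1) by simp
    qed
    have "M < N" using M \<open>N > 0\<close> prime_gt_1_nat[OF q(1)] by simp
    moreover have "squarefree M" using squarefree_mono[OF _ less.prems(1)] M by simp
    moreover have "QuadRes r a" if "r \<in> prime_factors M" for r
      using that less.prems(2)[of r] \<open>N > 0\<close> M by (auto simp: in_prime_factors_iff)
    ultimately obtain y where y: "[y\<^sup>2 = a] (mod M)" using less.IH[of M] by (auto simp: QuadRes_def)
    obtain x where x: "[x\<^sup>2 = a] (mod q)"
      using less.prems(2)[of q] q \<open>N > 0\<close> by (auto simp: QuadRes_def in_prime_factors_iff)
    have cop: "coprime (int q) (int M)" using \<open>coprime q M\<close> by simp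
    obtain z where z: "[z = x] (mod q)" "[z = y] (mod M)"
      using binary_chinese_remainder_int[OF cop] by blast
    have "[z\<^sup>2 = a] (mod q)" "[z\<^sup>2 = a] (mod M)"
      using cong_trans[OF cong_pow x] cong_trans[OF cong_pow y] z by blast+
    then have "[z\<^sup>2 = a] (mod (int q * int M))" using cop by (rule coprime_cong_mult)
    then show ?thesis by (auto simp: QuadRes_def M)
  qed
qed

text \<open>Thue's pigeonhole argument: the box has more points than there are residue pairs, and
  the difference of two colliding points is short. With \<open>m = 1\<close> and
  \<open>V = 0\<close> it is the classical two-variable case.\<close>

lemma small_lattice_vector:
  fixes m n W Z V :: nat and r s :: int
  assumes "m > 0" "n > 0" "m * n < (W + 1) * (Z + 1) * (V + 1)"
  obtains w z v :: int where "(w, z, v) \<noteq> (0, 0, 0)" "\<bar>w\<bar> \<le> W" "\<bar>z\<bar> \<le> Z" "\<bar>v\<bar> \<le> V"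
    "int m dvd z - r * v" "int n dvd z - s * w"
proof -
  define box where "box = {0..int W} \<times> {0..int Z} \<times> {0..int V}"
  define f where "f = (\<lambda>(w, z, v). ((z - r * v) mod int m, (z - s * w) mod int n))"
  have "f ` box \<subseteq> {0..<int m} \<times> {0..<int n}" using assms by (auto simp: f_def)
  then have "card (f ` box) \<le> card ({0..<int m} \<times> {0..<int n})" by (intro card_mono) auto
  also have "\<dots> = m * n" by (simp add: card_cartesian_product)
  also have "m * n < card box"
  proof -
    have "card box = (W + 1) * (Z + 1) * (V + 1)"
      by (simp add: box_def card_cartesian_product nat_add_distrib algebra_simps)
    with assms(3) show ?thesis by simp
  qed
  finally have "\<not> inj_on f box" using pigeonhole by blast
  then obtain a b where "a \<in> box" "b \<in> box" "a \<noteq> b" "f a = f b" unfolding inj_on_def by blast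
  then obtain w z v w' z' v' where *:
    "{0..int W} \<supseteq> {w, w'}" "{0..int Z} \<supseteq> {z, z'}" "{0..int V} \<supseteq> {v, v'}" "(w, z, v) \<noteq> (w', z', v')"
    "(z - r * v) mod int m = (z' - r * v') mod int m" "(z - s * w) mod int n = (z' - s * w') mod int n"
    by (cases a; cases b) (auto simp: box_def f_def)
  show ?thesis
  proof (rule that)
    show "int m dvd (z - z') - r * (v - v')" "int n dvd (z - z') - s * (w - w')"
      using *(5,6) by (simp_all add: mod_eq_dvd_iff algebra_simps)
  qed (use *(1-4) in auto)
qed

lemma prime_not_square:
  fixes p :: nat
  assumes "prime p"
  shows "x\<^sup>2 \<noteq> p"
  using assms prime_power_iff[of x 2] by auto

lemma prime_1_mod_4_sum_two_squares:
  fixes p :: nat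
  assumes "prime p" "p mod 4 = 1"
  obtains u v :: int where "int p = u\<^sup>2 + v\<^sup>2"
proof -
  have "p > 2" using prime_gt_1_nat[OF assms(1)] assms(2) by (cases "p = 2") auto
  have "even ((p - 1) div 2)" using assms(2) by presburger
  then have "[Legendre (-1) p = 1] (mod p)"
    using euler_criterion[OF assms(1) \<open>p > 2\<close>, of "-1"] by simp
  then have "int p dvd Legendre (-1) p - 1" by (simp add: cong_iff_dvd_diff)
  then have "Legendre (-1) p = 1"
    using Legendre_values[of "-1" p] \<open>p > 2\<close> by (auto dest!: zdvd_imp_le[rotated] simp: zdvd_not_zless)
  then obtain s where s: "[s\<^sup>2 = -1] (mod p)" by (auto simp: Legendre_eq_1_iff QuadRes_def)
  define W where "W = floor_sqrt p"
  have "p < (W + 1)\<^sup>2" using Suc_floor_sqrt_power2_gt[of p] by (simp add: W_def)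
  then have "1 * p < (W + 1) * (W + 1) * (0 + 1)" by (simp add: power2_eq_square)
  then obtain w z v where *: "(w, z, v) \<noteq> (0, 0, 0)" "\<bar>w\<bar> \<le> int W" "\<bar>z\<bar> \<le> int W" "\<bar>v\<bar> \<le> int 0"
    "int 1 dvd z - 0 * v" "int p dvd z - s * w"
    using small_lattice_vector[of 1 p W W 0 0 s] \<open>p > 2\<close> by auto
  have "W\<^sup>2 < p" using floor_sqrt_power2_le[of p] prime_not_square[OF assms(1), of W] by (simp add: W_def le_less)
  then have "(int W)\<^sup>2 < p" by (metis of_nat_less_iff of_nat_power)
  moreover have "w\<^sup>2 \<le> (int W)\<^sup>2" "z\<^sup>2 \<le> (int W)\<^sup>2"
    using *(2,3) by (intro abs_le_square_iff[THEN iffD1]; simp)+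
  ultimately have "w\<^sup>2 < p" "z\<^sup>2 < p" by linarith+
  have "z\<^sup>2 + w\<^sup>2 = (z - s * w) * (z + s * w) + (s\<^sup>2 - (-1)) * w\<^sup>2" by (simp add: algebra_simps power2_eq_square)
  moreover have "int p dvd s\<^sup>2 - (-1)" using s by (simp only: cong_iff_dvd_diff)
  ultimately have "int p dvd z\<^sup>2 + w\<^sup>2" using *(6) by (metis dvd_add dvd_mult2)
  then obtain c where c: "z\<^sup>2 + w\<^sup>2 = int p * c" by (elim dvdE)
  have "z\<^sup>2 + w\<^sup>2 > 0" using *(1,4) by (simp add: sum_power2_gt_zero_iff)
  \<comment> \<open>A multiple of \<open>p\<close> strictly between 0 and \<open>2 * p\<close> is
    \<open>p\<close> itself; strictness holds because a prime is not a square.\<close>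
  then have "int p * 0 < int p * c" "int p * c < int p * 2" using c \<open>w\<^sup>2 < p\<close> \<open>z\<^sup>2 < p\<close> by linarith+
  then have "c = 1" by (simp add: zero_less_mult_iff)
  with c show ?thesis using that[of z w] by simp
qed

text \<open>
  The form \<open>M w\<^sup>2 - z\<^sup>2 - p v\<^sup>2\<close> is divisible by \<open>M p\<close> on a lattice of index \<open>M p\<close>; a short vector of
  the lattice gives it one of the values \<open>0\<close> and \<open>- M p\<close>. The second one is reduced to the first
  by multiplicativity of \<open>x\<^sup>2 + p y\<^sup>2\<close>.
\<close>

lemma Legendre_equation:
  fixes M p :: nat
  assumes M: "M mod 4 = 2" and p: "prime p" "odd p" "\<not> p dvd M"
    and r: "QuadRes M (- int p)" and s: "QuadRes p M"
  obtains w A B :: int where "w \<noteq> 0" "M * w\<^sup>2 = A\<^sup>2 + p * B\<^sup>2"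
proof -
  have "M > 0" using M by (intro Nat.gr0I) auto
  have "p > 0" using p(1) prime_gt_0_nat by blast
  obtain r where r: "[r\<^sup>2 = - int p] (mod M)" using r by (auto simp: QuadRes_def)
  obtain s where s: "[s\<^sup>2 = int M] (mod p)" using s by (auto simp: QuadRes_def)
  define W Z V where "W = floor_sqrt p" and "Z = floor_sqrt (M * p)" and "V = floor_sqrt M"
  \<comment> \<open>The three side lengths approximate the square roots of \<open>p\<close>,
    \<open>M * p\<close> and \<open>M\<close>, whose product is the number \<open>M * p\<close> of
    residue pairs; rounding up makes the box large enough.\<close>
  have "(M * p)\<^sup>2 = p * (M * p) * M" by (simp add: power2_eq_square)
  also have "\<dots> < (W + 1)\<^sup>2 * (Z + 1)\<^sup>2 * (V + 1)\<^sup>2"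
    using Suc_floor_sqrt_power2_gt[of p] Suc_floor_sqrt_power2_gt[of "M * p"] Suc_floor_sqrt_power2_gt[of M]
    unfolding W_def Z_def V_def Suc_eq_plus1 by (intro mult_strict_mono) (use \<open>M > 0\<close> \<open>p > 0\<close> in auto)
  also have "\<dots> = ((W + 1) * (Z + 1) * (V + 1))\<^sup>2" by (simp only: power_mult_distrib)
  finally have "M * p < (W + 1) * (Z + 1) * (V + 1)" by (rule power2_less_imp_less) simp
  then obtain w z v where *: "(w, z, v) \<noteq> (0, 0, 0)" "\<bar>w\<bar> \<le> int W" "\<bar>z\<bar> \<le> int Z" "\<bar>v\<bar> \<le> int V"
    "int M dvd z - r * v" "int p dvd z - s * w"
    by (rule small_lattice_vector[OF \<open>M > 0\<close> \<open>p > 0\<close>, of _ _ _ r s])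
  have "W\<^sup>2 < p" using floor_sqrt_power2_le[of p] prime_not_square[OF p(1), of W] by (simp add: W_def le_less)
  \<comment> \<open>\<open>M\<close> is 2 modulo 4, hence no square. The resulting strict bound on
    \<open>v\<close> excludes the quotient \<open>c = -2\<close>.\<close>
  moreover have "V\<^sup>2 \<noteq> M"
  proof
    assume "V\<^sup>2 = M"
    moreover have "V\<^sup>2 mod 4 = (V mod 4)\<^sup>2 mod 4" by (simp add: power_mod)
    moreover have "V mod 4 = 0 \<or> V mod 4 = 1 \<or> V mod 4 = 2 \<or> V mod 4 = 3" by presburger
    ultimately show False using M by auto
  qed
  then have "V\<^sup>2 < M" using floor_sqrt_power2_le[of M] by (simp add: V_def le_less)
  moreover have "Z\<^sup>2 \<le> M * p" by (simp add: Z_def)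
  ultimately have "(int W)\<^sup>2 < p" "(int V)\<^sup>2 < M" "(int Z)\<^sup>2 \<le> int M * int p"
    by (metis of_nat_less_iff of_nat_power, metis of_nat_less_iff of_nat_power, metis of_nat_le_iff of_nat_mult of_nat_power)
  moreover have "w\<^sup>2 \<le> (int W)\<^sup>2" "v\<^sup>2 \<le> (int V)\<^sup>2" "z\<^sup>2 \<le> (int Z)\<^sup>2"
    using *(2-4) by (intro abs_le_square_iff[THEN iffD1]; simp)+
  ultimately have bounds: "w\<^sup>2 < p" "v\<^sup>2 < M" "z\<^sup>2 \<le> int M * int p" by linarith+
  define Q where "Q = int M * w\<^sup>2 - z\<^sup>2 - p * v\<^sup>2"
  have "Q = int M * w\<^sup>2 - (z - r * v) * (z + r * v) - (r\<^sup>2 - (- int p)) * v\<^sup>2"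
    by (simp add: Q_def algebra_simps power2_eq_square)
  moreover have "int M dvd r\<^sup>2 - (- int p)" using r by (simp only: cong_iff_dvd_diff)
  ultimately have "int M dvd Q" using *(5) by (metis dvd_diff dvd_mult2 dvd_triv_left)
  have "Q = - (z - s * w) * (z + s * w) - (s\<^sup>2 - int M) * w\<^sup>2 - p * v\<^sup>2"
    by (simp add: Q_def algebra_simps power2_eq_square)
  moreover have "int p dvd s\<^sup>2 - int M" using s by (simp only: cong_iff_dvd_diff)
  ultimately have "int p dvd Q" using *(6) by (metis dvd_diff dvd_mult2 dvd_triv_left dvd_minus_iff)
  moreover have "coprime (int M) (int p)"
    using prime_imp_coprime[OF p(1,3)] by (simp add: coprime_commute)
  ultimately obtain c where c: "Q = (int M * int p) * c" using \<open>int M dvd Q\<close> divides_mult by blast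
  have Mp: "int M * int p > 0" using \<open>M > 0\<close> \<open>p > 0\<close> by simp
  have "int M * w\<^sup>2 < int M * int p" "int p * v\<^sup>2 < int p * int M"
    using bounds \<open>M > 0\<close> \<open>p > 0\<close> by simp_all
  moreover have "0 \<le> int M * w\<^sup>2" "0 \<le> int p * v\<^sup>2" "0 \<le> z\<^sup>2" by simp_all
  moreover have "int p * int M = int M * int p" by simp
  ultimately have "(int M * int p) * c < (int M * int p) * 1" "(int M * int p) * (-2) < (int M * int p) * c"
    using c bounds(3) unfolding Q_def by linarith+
  then have "c = 0 \<or> c = -1" using Mp by (auto simp only: mult_less_cancel_left_pos)
  then show ?thesis
  proof
    assume "c = 0"
    then have eq: "M * w\<^sup>2 = z\<^sup>2 + p * v\<^sup>2" using c by (simp add: Q_def)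
    have "w \<noteq> 0"
    proof
      assume "w = 0"
      then have "z\<^sup>2 + p * v\<^sup>2 = 0" using eq by simp
      moreover have "0 \<le> z\<^sup>2" "0 \<le> p * v\<^sup>2" by simp_all
      ultimately have "z\<^sup>2 = 0" "p * v\<^sup>2 = 0" by linarith+
      then show False using \<open>w = 0\<close> *(1) \<open>p > 0\<close> by simp
    qed
    with eq show ?thesis using that by blast
  next
    assume "c = -1"
    then have eq: "M * (w\<^sup>2 + p) = z\<^sup>2 + p * v\<^sup>2" using c by (simp add: Q_def algebra_simps)
    have "M * (w\<^sup>2 + p)\<^sup>2 = (M * (w\<^sup>2 + p)) * (w\<^sup>2 + p)" by (simp add: power2_eq_square)
    also have "\<dots> = (z * w - p * v)\<^sup>2 + p * (z + v * w)\<^sup>2"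
      unfolding eq by (simp add: algebra_simps power2_eq_square)
    finally have "M * (w\<^sup>2 + p)\<^sup>2 = (z * w - p * v)\<^sup>2 + p * (z + v * w)\<^sup>2" .
    moreover have "w\<^sup>2 + p \<noteq> 0" using \<open>p > 0\<close> by (smt (verit) of_nat_0_less_iff zero_le_power2)
    ultimately show ?thesis using that by blast
  qed
qed

section \<open>Descent from rational to integral sums of three squares\<close>

lemma nearest_multiple:
  fixes a t :: int
  assumes "t > 0"
  obtains y r where "a = t * y + r" "4 * r\<^sup>2 \<le> t\<^sup>2"
proof -
  define y where "y = (2 * a + t) div (2 * t)"
  define r where "r = a - t * y"
  have "2 * a + t = 2 * t * y + (2 * a + t) mod (2 * t)" by (simp add: y_def)
  moreover have "0 \<le> (2 * a + t) mod (2 * t)" "(2 * a + t) mod (2 * t) < 2 * t" using assms by simp_all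
  moreover have "2 * r = 2 * a - 2 * t * y" by (simp add: r_def algebra_simps)
  ultimately have "\<bar>2 * r\<bar> \<le> \<bar>t\<bar>" by linarith
  then have "(2 * r)\<^sup>2 \<le> t\<^sup>2" by (simp only: abs_le_square_iff)
  then have "4 * r\<^sup>2 \<le> t\<^sup>2" by (simp add: power_mult_distrib)
  moreover have "a = t * y + r" by (simp add: r_def)
  ultimately show ?thesis using that by blast
qed

text \<open>
  Davenport and Cassels: the line through a rational point of the sphere and a nearest integral
  point meets the sphere again in a point of smaller denominator.
\<close>

lemma sum_three_squares_descent:
  fixes n a b c :: int
  assumes "t > 0" "(int t)\<^sup>2 * n = a\<^sup>2 + b\<^sup>2 + c\<^sup>2"
  shows "\<exists>x y z. n = x\<^sup>2 + y\<^sup>2 + z\<^sup>2"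
  using assms
proof (induction t arbitrary: a b c rule: less_induct)
  case (less t)
  define T where "T = int t"
  have T: "T > 0" "T\<^sup>2 * n = a\<^sup>2 + b\<^sup>2 + c\<^sup>2" using less.prems by (simp_all add: T_def)
  obtain x r where x: "a = T * x + r" "4 * r\<^sup>2 \<le> T\<^sup>2" using nearest_multiple[OF T(1)] .
  obtain y s where y: "b = T * y + s" "4 * s\<^sup>2 \<le> T\<^sup>2" using nearest_multiple[OF T(1)] .
  obtain z u where z: "c = T * z + u" "4 * u\<^sup>2 \<le> T\<^sup>2" using nearest_multiple[OF T(1)] .
  define D where "D = a * x + b * y + c * z"
  define Y where "Y = x\<^sup>2 + y\<^sup>2 + z\<^sup>2"
  \<comment> \<open>\<open>T'\<close> is \<open>T\<close> times the squared distance from (a, b,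
    c)/T to (x, y, z). Three coordinates, each off by at most 1/2, give
    \<open>T' \<le> 3/4 * T\<close>; this is where dimension three fits.\<close>
  define T' where "T' = T * n - 2 * D + T * Y"
  have "T * T' = a\<^sup>2 + b\<^sup>2 + c\<^sup>2 - 2 * T * D + T\<^sup>2 * Y"
    unfolding T'_def T(2)[symmetric] by (simp add: algebra_simps power2_eq_square)
  also have "\<dots> = r\<^sup>2 + s\<^sup>2 + u\<^sup>2"
    unfolding D_def Y_def x(1) y(1) z(1) by (simp add: algebra_simps power2_eq_square)
  finally have T': "T * T' = r\<^sup>2 + s\<^sup>2 + u\<^sup>2" .
  show ?case
  proof (cases "T' = 0")
    case True
    then have "r\<^sup>2 + s\<^sup>2 + u\<^sup>2 = 0" using T' by simp
    moreover have "0 \<le> r\<^sup>2" "0 \<le> s\<^sup>2" "0 \<le> u\<^sup>2" by simp_all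
    ultimately have "r\<^sup>2 = 0" "s\<^sup>2 = 0" "u\<^sup>2 = 0" by linarith+
    then have "T\<^sup>2 * n = T\<^sup>2 * Y" using T(2) x(1) y(1) z(1) by (simp add: Y_def algebra_simps)
    then show ?thesis using T(1) by (auto simp: Y_def)
  next
    case False
    have "0 \<le> T * T'" unfolding T' by simp
    then have "T' > 0" using T(1) False by (simp add: zero_le_mult_iff)
    have "4 * (T * T') \<le> 3 * (T * T)" using T' x(2) y(2) z(2) by (simp add: power2_eq_square)
    also have "\<dots> < 4 * (T * T)" using T(1) by simp
    finally have "T' < T" using T(1) by simp
    \<comment> \<open>The second intersection point, with denominator \<open>T'\<close>, is the
      combination of (a, b, c) and (x, y, z) with coefficients \<open>A\<close> and
      \<open>B\<close>.\<close>
    define A B where "A = Y - n" and "B = 2 * (n * T - D)"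
    have T'_eq: "T' = A * T + B" by (simp add: T'_def A_def B_def algebra_simps)
    have "(A * a + B * x)\<^sup>2 + (A * b + B * y)\<^sup>2 + (A * c + B * z)\<^sup>2 = A\<^sup>2 * (T\<^sup>2 * n) + 2 * A * B * D + B\<^sup>2 * Y"
      unfolding T(2) D_def Y_def by (simp add: algebra_simps power2_eq_square)
    also have "\<dots> = T'\<^sup>2 * n"
      unfolding T'_eq A_def B_def by (simp add: algebra_simps power2_eq_square)
    finally have "(int (nat T'))\<^sup>2 * n = (A * a + B * x)\<^sup>2 + (A * b + B * y)\<^sup>2 + (A * c + B * z)\<^sup>2"
      using \<open>T' > 0\<close> by simp
    then show ?thesis using less.IH[of "nat T'"] \<open>T' > 0\<close> \<open>T' < T\<close> by (auto simp: T_def)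
  qed
qed

text \<open>As \<open>2 * N\<close> is 2 modulo 4, exactly two of the squares are odd, and for these
  (a^2 + b^2)/2 = ((a + b)/2)^2 + ((a - b)/2)^2. The even one supplies the term with coefficient
  2.\<close>

lemma sum_three_squares_imp_form_1_1_2:
  fixes N a b c :: int
  assumes "odd N" "2 * N = a\<^sup>2 + b\<^sup>2 + c\<^sup>2"
  shows "\<exists>x y z. N = x\<^sup>2 + y\<^sup>2 + 2 * z\<^sup>2"
proof -
  have main: "\<exists>x y z. N = x\<^sup>2 + y\<^sup>2 + 2 * z\<^sup>2"
    if abc: "odd a" "odd b" "even c" "2 * N = a\<^sup>2 + b\<^sup>2 + c\<^sup>2" for a b c :: int
  proof -
    obtain x where x: "a + b = 2 * x" using abc(1,2) by (meson evenE odd_even_add)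
    obtain z where z: "c = 2 * z" using abc(3) by blast
    have a: "a = 2 * x - b" using x by simp
    have "2 * N = 2 * (x\<^sup>2 + (x - b)\<^sup>2 + 2 * z\<^sup>2)"
      unfolding abc(4) a z by (simp add: algebra_simps power2_eq_square)
    then have "N = x\<^sup>2 + (x - b)\<^sup>2 + 2 * z\<^sup>2" by simp
    then show ?thesis by blast
  qed
  have "even (a\<^sup>2 + b\<^sup>2 + c\<^sup>2)" using assms(2) by (metis dvd_triv_left)
  then consider "odd a" "odd b" "even c" | "odd a" "even b" "odd c" | "even a" "odd b" "odd c"
    | "even a" "even b" "even c" by auto
  then show ?thesis
  proof cases
    case 4
    then have "4 dvd a\<^sup>2 + b\<^sup>2 + c\<^sup>2" by (auto elim!: evenE simp: power_mult_distrib)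
    then have "even N" unfolding assms(2)[symmetric] by presburger
    then show ?thesis using assms(1) by simp
  qed (use main[of a b c] main[of a c b] main[of b c a] assms(2) in \<open>simp_all add: add_ac\<close>)
qed

section \<open>Choice of the auxiliary prime for twice an odd squarefree number\<close>

lemma Legendre_prod:
  fixes p :: nat
  assumes "prime p" "p > 2" "finite A"
  shows "Legendre (\<Prod>i\<in>A. f i) p = (\<Prod>i\<in>A. Legendre (f i) p)"
  using assms(3)
  by (induction A rule: finite_induct) (simp_all add: Legendre_mult[OF assms(1,2)] Legendre_1[OF assms(1)])

lemma Legendre_reciprocity_1_mod_4:
  fixes p q :: nat
  assumes "prime p" "p mod 4 = 1" "prime q" "q > 2" "p \<noteq> q"
  shows "Legendre q p = Legendre p q"
proof -
  have "p > 2" using prime_gt_1_nat[OF assms(1)] assms(2) by (cases "p = 2") auto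
  have "even ((p - 1) div 2)" using assms(2) by presburger
  then have "Legendre p q * Legendre q p = 1"
    using Quadratic_Reciprocity[OF assms(1) \<open>p > 2\<close> assms(3-5)] by simp
  then show ?thesis using Legendre_values[of p q] Legendre_values[of q p] by auto
qed

lemma squarefree_eq_prod_primes:
  fixes N :: nat
  assumes "squarefree N"
  shows "N = \<Prod>(prime_factors N)"
proof -
  have "N > 0" using assms by (intro Nat.gr0I) auto
  then have "N = (\<Prod>q\<in>prime_factors N. q ^ multiplicity q N)" by (rule prime_factorization_nat)
  also have "\<dots> = \<Prod>(prime_factors N)"
  proof (rule prod.cong)
    fix q assume "q \<in> prime_factors N"
    then have "multiplicity q N = 1"
      using assms \<open>N > 0\<close> squarefree_factorial_semiring'[of N] by simp
    then show "q ^ multiplicity q N = q" by simp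
  qed simp
  finally show ?thesis .
qed

lemma double_squarefree_sum_three_squares:
  fixes N :: nat
  assumes "odd N" "squarefree N"
  shows "\<exists>a b c :: int. 2 * int N = a\<^sup>2 + b\<^sup>2 + c\<^sup>2"
proof -
  define \<epsilon> where "\<epsilon> q = Legendre (-1) (int q)" for q
  have N0: "N > 0" using assms(1) by (intro Nat.gr0I) auto
  have q: "prime q" "q > 2" "q dvd N" if "q \<in> prime_factors N" for q
  proof -
    show pq: "prime q" "q dvd N" using that by auto
    then have "odd q" using assms(1) dvd_trans by blast
    then show "q > 2" using prime_gt_1_nat[OF pq(1)] by (cases "q = 2") auto
  qed
  have \<epsilon>: "\<epsilon> q \<in> {-1, 1}" if "q \<in> prime_factors N" for q
  proof -
    have "\<not> int q dvd -1" using q[OF that] by (simp add: dvd_minus_iff)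
    then have "\<epsilon> q \<noteq> 0" by (simp add: \<epsilon>_def Legendre_eq_0_iff)
    then show ?thesis using Legendre_values[of "-1" q] by (simp add: \<epsilon>_def)
  qed
  have \<epsilon>2: "\<epsilon> q * \<epsilon> q = 1" if "q \<in> prime_factors N" for q
    using \<epsilon>[OF that] by auto
  \<comment> \<open>By reciprocity \<delta> will be the symbol of \<open>N\<close> modulo
    \<open>p\<close>; prescribing the same value for the symbol of 2 makes \<open>2 * N\<close> a
    residue.\<close>
  define \<delta> where "\<delta> = (\<Prod>q\<in>prime_factors N. \<epsilon> q)"
  have \<delta>2: "\<delta> * \<delta> = 1"
    unfolding \<delta>_def prod.distrib[symmetric] by (intro prod.neutral ballI \<epsilon>2)
  then have \<delta>: "\<delta> \<in> {-1, 1}" by (auto simp: zmult_eq_1_iff)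
  then obtain p :: nat where p: "prime p" "p mod 4 = 1" "Legendre 2 p = \<delta>"
    "\<And>q. q \<in> prime_factors N \<Longrightarrow> Legendre p q = \<epsilon> q"
    using prime_with_prescribed_residues[OF assms, of \<epsilon> \<delta>] \<epsilon> by blast
  have "odd p" using p(2) by presburger
  then have "p > 2" using prime_gt_1_nat[OF p(1)] by (cases "p = 2") auto
  have "\<not> p dvd N"
  proof
    assume "p dvd N"
    then have "p \<in> prime_factors N" using p(1) N0 by (simp add: in_prime_factors_iff)
    then show False using p(4)[of p] \<epsilon>[of p] by (auto simp: Legendre_eq_0_iff[THEN iffD2])
  qed
  then have p2N: "\<not> p dvd 2 * N"
    using p(1) \<open>p > 2\<close> by (auto simp: prime_dvd_mult_iff dest: dvd_imp_le)
  have "squarefree (2 * N)"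
    using assms by (intro squarefree_mult_coprime) (auto simp: squarefree_prime)
  then have "QuadRes (int (2 * N)) (- int p)"
  proof (rule QuadRes_squarefree)
    fix q assume "q \<in> prime_factors (2 * N)"
    then have "q = 2 \<or> q \<in> prime_factors N"
      using N0 by (auto simp: in_prime_factors_iff prime_dvd_mult_iff primes_dvd_imp_eq)
    then show "QuadRes (int q) (- int p)"
    proof
      assume "q = 2"
      moreover have "[1\<^sup>2 = - int p] (mod 2)" using \<open>odd p\<close> by (simp add: cong_iff_dvd_diff)
      then have "QuadRes 2 (- int p)" unfolding QuadRes_def by blast
      ultimately show ?thesis by simp
    next
      assume qN: "q \<in> prime_factors N"
      have "Legendre (- int p) q = 1"
        using Legendre_mult[OF q(1,2)[OF qN], of "-1" p] p(4)[OF qN] \<epsilon>2[OF qN] by (simp add: \<epsilon>_def)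
      then show ?thesis by (simp add: Legendre_eq_1_iff)
    qed
  qed
  moreover have "QuadRes (int p) (int (2 * N))"
  proof -
    have "Legendre (int (2 * N)) p = Legendre 2 p * Legendre (int N) p"
      using Legendre_mult[OF p(1) \<open>p > 2\<close>, of 2 "int N"] by simp
    also have "int N = int (\<Prod>(prime_factors N))"
      using squarefree_eq_prod_primes[OF assms(2)] by (rule arg_cong)
    also have "\<dots> = (\<Prod>q\<in>prime_factors N. int q)" by simp
    also have "Legendre (\<Prod>q\<in>prime_factors N. int q) p = (\<Prod>q\<in>prime_factors N. Legendre q p)"
      using p(1) \<open>p > 2\<close> by (intro Legendre_prod) auto
    also have "\<dots> = \<delta>" unfolding \<delta>_def
    proof (rule prod.cong)
      fix q' assume q': "q' \<in> prime_factors N"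
      have "p \<noteq> q'" using q(3)[OF q'] \<open>\<not> p dvd N\<close> by auto
      then show "Legendre q' p = \<epsilon> q'"
        using Legendre_reciprocity_1_mod_4[OF p(1,2) q(1,2)[OF q']] p(4)[OF q'] by simp
    qed simp
    finally show ?thesis using p(3) \<delta>2 by (simp add: Legendre_eq_1_iff)
  qed
  moreover have "2 * N mod 4 = 2" using assms(1) by presburger
  ultimately obtain w A B :: int where w: "w \<noteq> 0" "int (2 * N) * w\<^sup>2 = A\<^sup>2 + int p * B\<^sup>2"
    using Legendre_equation[of "2 * N" p] p(1) \<open>odd p\<close> p2N by blast
  obtain u v :: int where "int p = u\<^sup>2 + v\<^sup>2" using prime_1_mod_4_sum_two_squares[OF p(1,2)] .
  then have "w\<^sup>2 * (2 * int N) = A\<^sup>2 + (u * B)\<^sup>2 + (v * B)\<^sup>2"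
    using w(2) by (simp add: algebra_simps power_mult_distrib)
  then show ?thesis
    using sum_three_squares_descent[of "nat \<bar>w\<bar>" "2 * int N" A "u * B" "v * B"] w(1) by simp
qed

theorem odd_represented_by_1_1_2:
  fixes N :: int
  assumes "odd N" "N > 0"
  shows "\<exists>x y z. N = x\<^sup>2 + y\<^sup>2 + 2 * z\<^sup>2"
proof -
  define M k where "M = squarefree_part (nat N)" and "k = square_part (nat N)"
  have N: "N = int M * (int k)\<^sup>2"
    using squarefree_decompose[of "nat N"] assms(2) by (simp add: M_def k_def flip: of_nat_power of_nat_mult)
  then have "odd M" using assms(1) by auto
  then obtain a b c :: int where "2 * int M = a\<^sup>2 + b\<^sup>2 + c\<^sup>2"
    using double_squarefree_sum_three_squares[of M] by (auto simp: M_def)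
  then obtain x y z where "int M = x\<^sup>2 + y\<^sup>2 + 2 * z\<^sup>2"
    using sum_three_squares_imp_form_1_1_2[of "int M" a b c] \<open>odd M\<close> by auto
  then have "N = (k * x)\<^sup>2 + (k * y)\<^sup>2 + 2 * (k * z)\<^sup>2"
    unfolding N by (simp add: algebra_simps)
  then show ?thesis by blast
qed

section \<open>The quaternary form\<close>

lemma qform_complete_square:
  fixes a b c x y z w :: int
  shows "4 * qform a b c x y z w =
    (2 * x)\<^sup>2 + 2 * (2 * y + a * w)\<^sup>2 + (4 * z + b * w)\<^sup>2 + (4 * c - 2 * a\<^sup>2 - b\<^sup>2) * w\<^sup>2"
  by (simp add: qform_def algebra_simps power2_eq_square)

text \<open>With \<open>w = 1\<close>, the real point where all three completed squares vanish
  isolates the last coefficient.\<close>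

lemma qform_positive_definite_imp:
  assumes "positive_definite4 (qform a b c)"
  shows "4 * c - 2 * a\<^sup>2 - b\<^sup>2 > 0"
proof -
  have "0 < (qform a b c 0 (- of_int a / 2) (- of_int b / 4) 1 :: real)"
    using assms unfolding positive_definite4_def by (metis one_neq_zero prod.inject)
  then have "0 < 4 * (qform a b c 0 (- of_int a / 2) (- of_int b / 4) 1 :: real)" by simp
  also have "\<dots> = real_of_int (4 * c - 2 * a\<^sup>2 - b\<^sup>2)"
    by (simp add: qform_def field_simps power2_eq_square)
  finally have "0 < real_of_int (4 * c - 2 * a\<^sup>2 - b\<^sup>2)" .
  then show ?thesis by (simp only: of_int_0_less_iff)
qed

lemma Gcd_4_dvd: "Gcd {x, y, z, w :: int} dvd x" "Gcd {x, y, z, w} dvd w"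
  by (rule Gcd_dvd; simp)+

text \<open>Taking \<open>w = 1\<close> makes primitivity automatic, and the bound on
  \<open>n\<close> is positivity of \<open>4 * n - t\<close>, which is odd because \<open>b\<close>
  is.\<close>

lemma primitively_represents_if_odd:
  fixes a b c n :: int
  assumes "odd b" and n: "4 * n > 4 * c - 2 * a\<^sup>2 - b\<^sup>2"
  shows "primitively_represents4 (qform a b c) n"
proof -
  define t where "t = 4 * c - 2 * a\<^sup>2 - b\<^sup>2"
  have "odd (4 * n - t)" using assms(1) by (simp add: t_def)
  then obtain X Z Y where rep: "4 * n - t = X\<^sup>2 + Z\<^sup>2 + 2 * Y\<^sup>2"
    using odd_represented_by_1_1_2[of "4 * n - t"] n by (auto simp: t_def)
  have main: "\<exists>x y z. qform a b c x y z 1 = n" if XZ: "even X" "odd Z" "4 * n - t = X\<^sup>2 + Z\<^sup>2 + 2 * Y\<^sup>2" for X Z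
  proof -
    obtain x where x: "X = 2 * x" using XZ(1) by blast
    have odd_sq: "u\<^sup>2 mod 4 = 1" if u: "odd u" for u :: int
    proof -
      obtain v where "u = 2 * v + 1" using u by (elim oddE)
      then have "u\<^sup>2 = 1 + 4 * (v\<^sup>2 + v)" by (simp add: power2_eq_square algebra_simps)
      then show ?thesis by presburger
    qed
    \<comment> \<open>Modulo 4 the odd squares cancel, so \<open>Y\<close> and \<open>a\<close> have
      equal parity.\<close>
    have "2 * Y\<^sup>2 - 2 * a\<^sup>2 = b\<^sup>2 - Z\<^sup>2 + 4 * (n - c - x\<^sup>2)"
      using XZ(3) by (simp add: x t_def power_mult_distrib)
    moreover have "4 dvd b\<^sup>2 - Z\<^sup>2"
      using odd_sq[OF assms(1)] odd_sq[OF XZ(2)] by (simp add: mod_eq_dvd_iff[symmetric])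
    ultimately have "even (Y\<^sup>2 - a\<^sup>2)" by presburger
    then have "even (Y - a)" by simp
    then obtain y where y: "Y = 2 * y + a" by (metis add.commute diff_add_cancel evenE)
    \<comment> \<open>The congruence modulo 4 is met by choosing the sign of
      \<open>Z\<close>.\<close>
    have "4 dvd Z - b \<or> 4 dvd - Z - b" using assms(1) XZ(2) by presburger
    then obtain Z' where Z': "Z'\<^sup>2 = Z\<^sup>2" "4 dvd Z' - b" by (metis power2_minus)
    then obtain z where z: "Z' = 4 * z + b" by (metis add.commute diff_add_cancel dvdE)
    have "4 * qform a b c x y z 1 = 4 * n"
      unfolding qform_complete_square using XZ(3) Z'(1) by (simp add: x y z t_def)
    then show ?thesis by auto
  qed
  have "odd X \<noteq> odd Z" using \<open>odd (4 * n - t)\<close> unfolding rep by auto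
  then obtain x y z where "qform a b c x y z 1 = n"
    using main[of X Z] main[of Z X] rep by (auto simp: add.commute)
  moreover have "Gcd {x, y, z, 1} = 1" by simp
  ultimately show ?thesis unfolding primitively_represents4_def by blast
qed

text \<open>Here the whole identity is divisible by 4: \<open>n\<close> equals
  \<open>x^2 + 2 * (y + a' * w)^2 + (2 * z + b' * w)^2 + t * w^2\<close> with the quartered, odd
  \<open>t\<close>. Only parities remain to be matched.\<close>

lemma primitively_represents_if_even:
  fixes a b c n :: int
  assumes "even a" "even c" "b mod 4 = 2" and n: "n > 4 * c - 2 * a\<^sup>2 - b\<^sup>2"
    and pos: "4 * c - 2 * a\<^sup>2 - b\<^sup>2 > 0"
  shows "primitively_represents4 (qform a b c) n"
proof -
  obtain a' c' where a': "a = 2 * a'" and c': "c = 2 * c'" using assms(1,2) by (meson evenE)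
  obtain b' where b': "b = 2 * b'" "odd b'"
  proof -
    have "b = 2 * (b div 2)" "odd (b div 2)" using assms(3) by presburger+
    then show ?thesis using that by blast
  qed
  define t where "t = 2 * c' - 2 * a'\<^sup>2 - b'\<^sup>2"
  have t4: "4 * c - 2 * a\<^sup>2 - b\<^sup>2 = 4 * t" by (simp add: t_def a' b' c' power_mult_distrib)
  have "odd t" using b'(2) by (simp add: t_def)
  \<comment> \<open>The parity of \<open>w\<close> is opposite to that of \<open>n\<close>, making
    \<open>n - t * w^2\<close> odd. The value 2 accounts for the bound \<open>4 * t\<close> on
    \<open>n\<close>; then \<open>x\<close> is odd, which keeps the representation
    primitive.\<close>
  define w :: int where "w = (if even n then 1 else 2)"
  have w2: "w\<^sup>2 = (if even n then 1 else 4)" by (simp add: w_def)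
  have "odd (n - t * w\<^sup>2)" using \<open>odd t\<close> by (simp add: w2)
  moreover have "n - t * w\<^sup>2 > 0" using n pos unfolding t4 w2 by auto
  ultimately obtain X Z Y where rep: "n - t * w\<^sup>2 = X\<^sup>2 + Z\<^sup>2 + 2 * Y\<^sup>2"
    using odd_represented_by_1_1_2 by blast
  have "odd X \<noteq> odd Z" using \<open>odd (n - t * w\<^sup>2)\<close> unfolding rep by auto
  then obtain x Z' where xZ: "n - t * w\<^sup>2 = x\<^sup>2 + Z'\<^sup>2 + 2 * Y\<^sup>2" "even Z' \<longleftrightarrow> even w"
    using rep that by (metis add.commute)
  have "even (Z' - b' * w)" using xZ(2) b'(2) by simp
  then obtain z where z: "Z' = 2 * z + b' * w" by (metis add.commute diff_add_cancel evenE)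
  define y where "y = Y - a' * w"
  have "4 * qform a b c x y z w = 4 * n"
    unfolding qform_complete_square t4 using xZ(1)
    by (simp add: y_def z a' b' algebra_simps power2_eq_square)
  then have rep: "qform a b c x y z w = n" by simp
  have "odd x" if "odd n"
    using xZ that \<open>odd t\<close> by (auto simp: w2 w_def dest: arg_cong[of _ _ even])
  have "Gcd {x, y, z, w} = 1"
  proof (cases "even n")
    case True
    then show ?thesis by (simp add: w_def)
  next
    case False
    let ?g = "Gcd {x, y, z, w}"
    have "?g dvd 2" using Gcd_4_dvd(2)[of x y z w] False by (simp add: w_def)
    moreover have "odd ?g" using \<open>odd n \<Longrightarrow> odd x\<close> False Gcd_4_dvd(1)[of x y z w] dvd_trans by blast
    ultimately have "?g dvd 1" using coprime_dvd_mult_right_iff[of ?g 2 1] by simp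
    then show ?thesis by (metis Gcd_int_greater_eq_0 zdvd1_eq abs_of_nonneg)
  qed
  with rep show ?thesis unfolding primitively_represents4_def by blast
qed

theorem theorem4p6:
  fixes a b c s t :: int
  assumes "a \<ge> 0" and "b \<ge> 0" and "c > 0"
    and "positive_definite4 (qform a b c)"
    and "(b mod 2 = 1 \<and> s = 2) \<or>
         (a mod 2 = 0 \<and> c mod 2 = 0 \<and> b mod 4 = 2 \<and> s = 1)"
    and "t = 4 * c - 2 * a^2 - b^2"
  shows "\<forall>n > 4 * s^2 * t. primitively_represents4 (qform a b c) n"
proof (intro allI impI)
  fix n assume n: "n > 4 * s^2 * t"
  have t: "t > 0" using qform_positive_definite_imp[OF assms(4)] assms(6) by simp
  from assms(5) show "primitively_represents4 (qform a b c) n"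
  proof
    assume "b mod 2 = 1 \<and> s = 2"
    then show ?thesis using n t assms(6) by (intro primitively_represents_if_odd) (auto simp: odd_iff_mod_2_eq_one)
  next
    assume "a mod 2 = 0 \<and> c mod 2 = 0 \<and> b mod 4 = 2 \<and> s = 1"
    then show ?thesis using n t assms(6) by (intro primitively_represents_if_even) (auto simp: even_iff_mod_2_eq_zero)
  qed
qed

end
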